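(* Let $t \ge 1$ be an integer. If $M$ is a simple rank-$r$ matroid with no $(t+1)$-claw, then $|E(M)| \ge f(r,t)$. If equality holds, then either (i) $M \cong M_{r,t}$, or (ii) $t < r < 2t$ and $M$ is the direct sum of coloops and exactly $r-t$ circuits, not all of which are triangles.
   Context: A claw of a matroid $M$ is a set that is both a flat and an independent set of $M$; a $k$-claw is a claw of size $k$. A triangle is a $3$-element circuit. For integers $r \ge 0$, $t \ge 1$, $M_{r,t}$ denotes the direct sum of $t$ (possibly empty, i.e. rank-$0$) binary projective geometries whose ranks sum to $r$ and pairwise differ by at most $1$, and $f(r,t) = |E(M_{r,t})|$; explicitly $f(r,t) = (t-a)2^{\lfloor r/t\rfloor} + a2^{\lceil r/t \rceil} - t$ where $a \in \{0,\dots,t-1\}$ and $a \equiv r \pmod t$. *)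

theory Defs
  imports Complex_Main
begin

definition matroid :: "'a set \<Rightarrow> ('a set \<Rightarrow> bool) \<Rightarrow> bool" where
  "matroid E I \<longleftrightarrow> finite E \<and> I {} \<and>
     (\<forall>X. I X \<longrightarrow> X \<subseteq> E) \<and>
     (\<forall>X Y. I Y \<and> X \<subseteq> Y \<longrightarrow> I X) \<and>
     (\<forall>X Y. I X \<and> I Y \<and> card X < card Y \<longrightarrow> (\<exists>e \<in> Y - X. I (insert e X)))"

definition mrank :: "('a set \<Rightarrow> bool) \<Rightarrow> 'a set \<Rightarrow> nat" where
  "mrank I X = Max (card ` {Y. Y \<subseteq> X \<and> I Y})"

definition matroid_rank :: "'a set \<Rightarrow> ('a set \<Rightarrow> bool) \<Rightarrow> nat" where
  "matroid_rank E I = mrank I E"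

definition mclosure :: "'a set \<Rightarrow> ('a set \<Rightarrow> bool) \<Rightarrow> 'a set \<Rightarrow> 'a set" where
  "mclosure E I X = {e \<in> E. mrank I (insert e X) = mrank I X}"

definition flat :: "'a set \<Rightarrow> ('a set \<Rightarrow> bool) \<Rightarrow> 'a set \<Rightarrow> bool" where
  "flat E I X \<longleftrightarrow> X \<subseteq> E \<and> mclosure E I X = X"

definition circuit :: "'a set \<Rightarrow> ('a set \<Rightarrow> bool) \<Rightarrow> 'a set \<Rightarrow> bool" where
  "circuit E I C \<longleftrightarrow> C \<subseteq> E \<and> \<not> I C \<and> (\<forall>x \<in> C. I (C - {x}))"

definition simple :: "'a set \<Rightarrow> ('a set \<Rightarrow> bool) \<Rightarrow> bool" where
  "simple E I \<longleftrightarrow> (\<forall>C. circuit E I C \<longrightarrow> card C \<ge> 3)"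

definition claw :: "'a set \<Rightarrow> ('a set \<Rightarrow> bool) \<Rightarrow> 'a set \<Rightarrow> bool" where
  "claw E I X \<longleftrightarrow> flat E I X \<and> I X"

definition has_k_claw :: "'a set \<Rightarrow> ('a set \<Rightarrow> bool) \<Rightarrow> nat \<Rightarrow> bool" where
  "has_k_claw E I k \<longleftrightarrow> (\<exists>X. claw E I X \<and> card X = k)"

definition matroid_iso ::
  "'a set \<Rightarrow> ('a set \<Rightarrow> bool) \<Rightarrow> 'b set \<Rightarrow> ('b set \<Rightarrow> bool) \<Rightarrow> bool" where
  "matroid_iso E1 I1 E2 I2 \<longleftrightarrow>
     (\<exists>\<phi>. bij_betw \<phi> E1 E2 \<and> (\<forall>X. X \<subseteq> E1 \<longrightarrow> (I1 X \<longleftrightarrow> I2 (\<phi> ` X))))"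

text \<open>Vectors of GF(2)^k are represented by their supports (subsets of {0..<k});
  vector addition is symmetric difference. A finite set of vectors is linearly
  independent over GF(2) iff no nonempty subset sums to zero.\<close>

definition gf2_sum :: "nat set set \<Rightarrow> nat set" where
  "gf2_sum T = {x. odd (card {A \<in> T. x \<in> A})}"

definition gf2_indep :: "nat set set \<Rightarrow> bool" where
  "gf2_indep S \<longleftrightarrow> (\<forall>T \<subseteq> S. T \<noteq> {} \<longrightarrow> gf2_sum T \<noteq> {})"

text \<open>M_{r,t}: direct sum of t binary projective geometries, component i having rank
  r div t + 1 if i < r mod t and r div t otherwise (ranks sum to r, differ by at most 1).
  Component i has ground set the nonzero vectors of GF(2)^(rank i), tagged by i.\<close>

definition Mrt_comp_rank :: "nat \<Rightarrow> nat \<Rightarrow> nat \<Rightarrow> nat" where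
  "Mrt_comp_rank r t i = r div t + (if i < r mod t then 1 else 0)"

definition Mrt_E :: "nat \<Rightarrow> nat \<Rightarrow> (nat \<times> nat set) set" where
  "Mrt_E r t = {(i, v). i < t \<and> v \<noteq> {} \<and> v \<subseteq> {0..<Mrt_comp_rank r t i}}"

definition Mrt_I :: "nat \<Rightarrow> nat \<Rightarrow> (nat \<times> nat set) set \<Rightarrow> bool" where
  "Mrt_I r t X \<longleftrightarrow> X \<subseteq> Mrt_E r t \<and> (\<forall>i < t. gf2_indep {v. (i, v) \<in> X})"

definition f :: "nat \<Rightarrow> nat \<Rightarrow> nat" where
  "f r t = (let a = r mod t in
     (t - a) * 2 ^ (r div t) + a * 2 ^ (nat \<lceil>real r / real t\<rceil>) - t)"

end

theory Submission
  imports Defs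
begin

text \<open>
  Given a cocircuit \<open>G - H\<close> of a flat \<open>G\<close> with at least two elements, some hyperplane \<open>H'\<close> of
  \<open>H\<close> separates two of them, so that the flats spanned by \<open>H'\<close> and one element of \<open>G - H\<close>
  split the cocircuit; the smallest of them halves its size at the cost of one rank. A cocircuit of
  size less than \<open>2 ^ d\<close> thus leads, after fewer than \<open>d\<close> steps, to a flat with a coloop, and
  repeating this inside the complement of the coloop builds a claw with one element per \<open>d\<close> ranks.
  Hence a matroid of rank \<open>n + 1\<close> without a \<open>(t + 1)\<close>-claw has a cocircuit of size at least
  \<open>2 ^ (n div t) = f (n + 1) t - f n t\<close>, and the bound follows by induction on the rank.

  In the extremal case no cocircuit is larger than that. Up to rank \<open>2 t\<close> this means that cocircuits
  have at most two elements, which forces the fundamental circuits of a basis to be disjoint. Beyond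
  rank \<open>2 t\<close>, some hyperplane \<open>H\<close> is extremal, and every hyperplane of \<open>H\<close> separating two elements
  of the cocircuit splits it into two halves, each spanning a further extremal hyperplane. Comparing
  the decompositions of these hyperplanes into projective geometries shows that the
  cocircuit extends a single summand of \<open>H\<close>.
\<close>

section \<open>The extremal function\<close>

lemma ceiling_div:
  fixes r t :: nat
  assumes "t \<ge> 1" "r mod t \<noteq> 0"
  shows "nat \<lceil>real r / real t\<rceil> = Suc (r div t)"
proof -
  have r: "real r = real t * real (r div t) + real (r mod t)"
    by (metis mult_div_mod_eq of_nat_add of_nat_mult)
  have m: "real (r mod t) < real t" using assms by simp
  have "\<lceil>real r / real t\<rceil> = int (Suc (r div t))"
  proof (rule ceiling_unique)
    show "of_int (int (Suc (r div t))) - 1 < real r / real t"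
      using assms r by (simp add: field_simps)
    show "real r / real t \<le> of_int (int (Suc (r div t)))"
      using assms m by (simp add: field_simps r)
  qed
  then show ?thesis by simp
qed

text \<open>Adding \<open>t\<close> on the left removes the truncated subtraction. If
  \<open>t\<close> divides \<open>r\<close>, the coefficient of the second power vanishes; otherwise
  the ceiling is \<open>Suc (r div t)\<close>, so one closed form covers both cases.\<close>

lemma f_plus:
  assumes "t \<ge> 1"
  shows "f r t + t = (t - r mod t) * 2 ^ (r div t) + (r mod t) * 2 ^ Suc (r div t)"
proof -
  let ?s = "(t - r mod t) * 2 ^ (r div t) + (r mod t) * 2 ^ Suc (r div t)"
  have "f r t = ?s - t"
    using ceiling_div[OF assms, of r] by (cases "r mod t = 0") (auto simp: f_def Let_def)
  moreover have "t \<le> ?s"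
  proof -
    have "t - r mod t \<le> (t - r mod t) * 2 ^ (r div t)" "r mod t \<le> (r mod t) * 2 ^ Suc (r div t)"
      by simp_all
    moreover have "r mod t \<le> t" using assms by (simp add: less_imp_le)
    ultimately show ?thesis by linarith
  qed
  ultimately show ?thesis by simp
qed

lemma f_0: "t \<ge> 1 \<Longrightarrow> f 0 t = 0"
  using f_plus[of t 0] by simp

text \<open>Passing from rank \<open>n\<close> to \<open>n + 1\<close> enlarges one smallest
  summand, of rank \<open>n div t\<close>, by one rank, and this adds \<open>2 ^ (n div t)\<close>
  points.\<close>

lemma f_Suc:
  assumes "t \<ge> 1"
  shows "f (Suc n) t = f n t + 2 ^ (n div t)"
proof -
  have m: "n mod t < t" using assms by simp
  have "f (Suc n) t + t = f n t + t + 2 ^ (n div t)"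
  \<comment> \<open>In the first case the last small summand grows, so all ranks become equal and
    the quotient changes.\<close>
  proof (cases "Suc (n mod t) = t")
    case True
    then have "Suc n mod t = 0" "Suc n div t = Suc (n div t)" "t - n mod t = 1"
      "n mod t = t - 1"
      by (auto simp: mod_Suc div_Suc)
    then have "f (Suc n) t + t = t * 2 ^ Suc (n div t)"
      "f n t + t = 2 ^ (n div t) + (t - 1) * 2 ^ Suc (n div t)"
      using f_plus[OF assms, of "Suc n"] f_plus[OF assms, of n] by simp_all
    moreover have "t * 2 ^ Suc (n div t) = (t - 1) * 2 ^ Suc (n div t) + 2 ^ Suc (n div t)"
      using assms by (cases t) auto
    ultimately show ?thesis by simp
  next
    case False
    then have e: "Suc n mod t = Suc (n mod t)" "Suc n div t = n div t"
      by (auto simp: mod_Suc div_Suc)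
    obtain k where k: "t - n mod t = Suc k" "t - Suc (n mod t) = k"
      using m by (metis Suc_diff_Suc)
    show ?thesis
      unfolding f_plus[OF assms] e k by simp
  qed
  then show ?thesis by simp
qed

text \<open>The increments are 1 up to rank \<open>t\<close> and 2 from there to rank
  \<open>2 * t\<close>; the truncated difference \<open>r - t\<close> covers both ranges.\<close>

lemma f_small:
  assumes "t \<ge> 1" "r \<le> 2 * t"
  shows "f r t = r + (r - t)"
  using assms(2)
proof (induction r)
  case 0
  then show ?case using f_0 assms by simp
next
  case (Suc n)
  show ?case
  proof (cases "n < t")
    case True
    then show ?thesis using Suc f_Suc[OF assms(1), of n] by simp
  next
    case False
    then have "n div t = 1" using Suc(2) by (intro div_nat_eqI) auto
    then show ?thesis using Suc False f_Suc[OF assms(1), of n] by simp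
  qed
qed

section \<open>Ranks of the summands of \<open>M_{r,t}\<close>\<close>

text \<open>The summand with index \<open>n mod t\<close> is the one that grows. Expressed through
  \<open>n\<close> instead of \<open>Suc n\<close>, the formula needs no separate case when
  \<open>t\<close> divides \<open>Suc n\<close>.\<close>

lemma Mrt_comp_rank_Suc:
  assumes "j < t"
  shows "Mrt_comp_rank (Suc n) t j = n div t + (if j \<le> n mod t then 1 else 0)"
  using assms by (auto simp: Mrt_comp_rank_def mod_Suc div_Suc)

lemma Mrt_comp_rank_small:
  assumes "j < t" "r \<le> 2 * t"
  shows "Mrt_comp_rank r t j = (if j < r - t then 2 else if j < r then 1 else 0)"
proof -
  consider "r < t" | "t \<le> r" "r < 2 * t" | "r = 2 * t" using assms by linarith
  then show ?thesis
  proof cases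
    case 1
    then show ?thesis using assms by (simp add: Mrt_comp_rank_def)
  next
    case 2
    then have "r div t = 1" by (intro div_nat_eqI) auto
    moreover have "r mod t = r - t" using 2 by (simp add: le_mod_geq)
    ultimately show ?thesis using assms 2 by (simp add: Mrt_comp_rank_def)
  next
    case 3
    then show ?thesis using assms by (simp add: Mrt_comp_rank_def)
  qed
qed

lemma sum_Mrt_comp_rank:
  assumes "t \<ge> 1"
  shows "(\<Sum>j<t. Mrt_comp_rank r t j) = r"
proof -
  have "(\<Sum>j<t. if j < r mod t then 1 else 0) = card ({..<t} \<inter> {j. j < r mod t})"
    by (simp add: sum.If_cases)
  moreover have "{..<t} \<inter> {j. j < r mod t} = {..<r mod t}"
    using assms mod_less_divisor[of t r] by fastforce
  ultimately show ?thesis by (simp add: Mrt_comp_rank_def sum.distrib)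
qed

lemma gf2_sum_insert:
  assumes "finite V" "v \<notin> V"
  shows "i \<in> gf2_sum (insert v V) \<longleftrightarrow> (i \<in> v) \<noteq> (i \<in> gf2_sum V)"
proof -
  have "{A \<in> insert v V. i \<in> A} = (if i \<in> v then insert v {A \<in> V. i \<in> A} else {A \<in> V. i \<in> A})"
    by auto
  then show ?thesis using assms by (auto simp: gf2_sum_def)
qed

section \<open>Simple matroids\<close>

locale simple_matroid =
  fixes E :: "'a set" and I :: "'a set \<Rightarrow> bool"
  assumes matroid: "matroid E I" and simple: "simple E I"
begin

abbreviation rk :: "'a set \<Rightarrow> nat" where "rk \<equiv> mrank I"
abbreviation cl :: "'a set \<Rightarrow> 'a set" where "cl \<equiv> mclosure E I"
abbreviation fl :: "'a set \<Rightarrow> bool" where "fl \<equiv> flat E I"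

section \<open>Rank, bases and closure\<close>

lemma finite_ground: "finite E"
  using matroid by (auto simp: matroid_def)

lemma indep_empty: "I {}"
  using matroid by (auto simp: matroid_def)

lemma indep_subset_ground: "I X \<Longrightarrow> X \<subseteq> E"
  using matroid by (auto simp: matroid_def)

lemma indep_finite: "I X \<Longrightarrow> finite X"
  using indep_subset_ground finite_ground finite_subset by blast

lemma indep_subset: "I Y \<Longrightarrow> X \<subseteq> Y \<Longrightarrow> I X"
  using matroid unfolding matroid_def by blast

lemma indep_augment: "I X \<Longrightarrow> I Y \<Longrightarrow> card X < card Y \<Longrightarrow> \<exists>e\<in>Y - X. I (insert e X)"
  using matroid unfolding matroid_def by blast

lemma finite_indep_subsets: "finite {Y. Y \<subseteq> X \<and> I Y}"
  by (rule finite_subset[of _ "Pow E"]) (auto simp: finite_ground dest: indep_subset_ground)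

lemma card_le_rk: "Y \<subseteq> X \<Longrightarrow> I Y \<Longrightarrow> card Y \<le> rk X"
  unfolding mrank_def by (rule Max_ge) (auto simp: finite_indep_subsets)

lemma basis_exists: "\<exists>B. B \<subseteq> X \<and> I B \<and> card B = rk X"
proof -
  have "Max (card ` {Y. Y \<subseteq> X \<and> I Y}) \<in> card ` {Y. Y \<subseteq> X \<and> I Y}"
    by (rule Max_in) (use finite_indep_subsets indep_empty in auto)
  then show ?thesis unfolding mrank_def by auto
qed

lemma basis_extend:
  assumes "I J" "J \<subseteq> X"
  obtains B where "J \<subseteq> B" "B \<subseteq> X" "I B" "card B = rk X"
proof -
  have "\<exists>B. J \<subseteq> B \<and> B \<subseteq> X \<and> I B \<and> card B = rk X"
    using assms
  proof (induction "rk X - card J" arbitrary: J)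
    case 0
    with card_le_rk[of J X] show ?case by auto
  next
    case (Suc m)
    obtain B where B: "B \<subseteq> X" "I B" "card B = rk X" using basis_exists by blast
    have lt: "card J < card B" using Suc(2) B(3) by linarith
    obtain e where e: "e \<in> B - J" "I (insert e J)"
      using indep_augment[OF Suc(3) B(2) lt] by blast
    have c: "card (insert e J) = Suc (card J)" using e indep_finite[OF Suc(3)] by simp
    have "\<exists>B. insert e J \<subseteq> B \<and> B \<subseteq> X \<and> I B \<and> card B = rk X"
    proof (rule Suc(1))
      show "m = rk X - card (insert e J)" using Suc(2) c by linarith
    qed (use e B Suc(4) in auto)
    then show ?case by blast
  qed
  with that show ?thesis by blast
qed

lemma rk_mono:
  assumes "X \<subseteq> Y"
  shows "rk X \<le> rk Y"
proof -
  obtain B where B: "B \<subseteq> X" "I B" "card B = rk X" using basis_exists by blast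
  then show ?thesis using card_le_rk[of B Y] assms by simp
qed

lemma rk_le_card:
  assumes "finite X"
  shows "rk X \<le> card X"
proof -
  obtain B where B: "B \<subseteq> X" "I B" "card B = rk X" using basis_exists by blast
  then show ?thesis using card_mono[OF assms B(1)] by simp
qed

lemma rk_indep: "I X \<Longrightarrow> rk X = card X"
  using rk_le_card[OF indep_finite] card_le_rk[of X X] by (simp add: le_antisym)

lemma rk_empty: "rk {} = 0"
  using rk_indep[OF indep_empty] by simp

lemma indep_if_rk:
  assumes "finite X" "card X \<le> rk X"
  shows "I X"
proof -
  obtain B where B: "B \<subseteq> X" "I B" "card B = rk X" using basis_exists by blast
  then show ?thesis using card_seteq[OF assms(1) B(1)] assms by simp
qed

lemma rk_insert_le: "rk (insert x X) \<le> Suc (rk X)"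
proof -
  obtain J where J: "J \<subseteq> insert x X" "I J" "card J = rk (insert x X)" using basis_exists by blast
  have "card (J - {x}) \<le> rk X" using J indep_subset[OF J(2), of "J - {x}"] by (intro card_le_rk) auto
  moreover have "card J \<le> Suc (card (J - {x}))"
    using card_Suc_Diff1[OF indep_finite[OF J(2)], of x] by (cases "x \<in> J") auto
  ultimately show ?thesis using J by simp
qed

lemma in_cl: "e \<in> cl X \<longleftrightarrow> e \<in> E \<and> rk (insert e X) = rk X"
  by (auto simp: mclosure_def)

lemma cl_subset_ground: "cl X \<subseteq> E"
  by (auto simp: in_cl)

lemma cl_increasing: "X \<subseteq> E \<Longrightarrow> X \<subseteq> cl X"
  by (auto simp: in_cl insert_absorb)

lemma rk_insert_not_in_cl: "e \<in> E \<Longrightarrow> e \<notin> cl X \<Longrightarrow> rk (insert e X) = Suc (rk X)"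
  using rk_insert_le[of e X] rk_mono[OF subset_insertI, of X e] by (auto simp: in_cl)

lemma indep_insert:
  assumes "I B" "e \<in> E" "e \<notin> cl B"
  shows "I (insert e B)"
  using rk_insert_not_in_cl[OF assms(2,3)] rk_indep[OF assms(1)] indep_finite[OF assms(1)]
  by (intro indep_if_rk) (auto simp: card_insert_if)

lemma indep_insertD:
  assumes "I (insert e B)" "e \<notin> B"
  shows "e \<notin> cl B"
proof -
  have "I B" using assms indep_subset by blast
  then show ?thesis
    using assms rk_indep[of B] rk_indep[of "insert e B"] indep_finite by (simp add: in_cl)
qed

text \<open>If \<open>e\<close> lay in \<open>cl B\<close> but outside \<open>cl X\<close>, a basis
  of \<open>insert e X\<close> extending \<open>B\<close> would have a further element
  \<open>j\<close>; it differs from \<open>e\<close>, so it lies in \<open>X\<close> and contradicts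
  the maximality of \<open>B\<close>.\<close>

lemma cl_basis:
  assumes "B \<subseteq> X" "I B" "card B = rk X"
  shows "cl X = cl B"
proof (rule set_eqI)
  fix e
  have rB: "rk B = rk X" using rk_indep assms by simp
  show "e \<in> cl X \<longleftrightarrow> e \<in> cl B"
  proof
    assume "e \<in> cl X"
    then have "rk (insert e B) \<le> rk B"
      using rk_mono[of "insert e B" "insert e X"] assms rB by (auto simp: in_cl)
    then show "e \<in> cl B"
      using \<open>e \<in> cl X\<close> rk_mono[OF subset_insertI, of B e] by (auto simp: in_cl)
  next
    assume e: "e \<in> cl B"
    show "e \<in> cl X"
    proof (rule ccontr)
      assume "e \<notin> cl X"
      with e have r: "rk (insert e X) = Suc (rk X)"
        by (intro rk_insert_not_in_cl) (auto simp: in_cl)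
      obtain J where J: "B \<subseteq> J" "J \<subseteq> insert e X" "I J" "card J = rk (insert e X)"
        using basis_extend[of B "insert e X"] assms by blast
      then obtain j where j: "j \<in> J - B"
        using r assms(3) by (metis Diff_eq_empty_iff ex_in_conv n_not_Suc_n subset_antisym)
      have Ij: "I (insert j B)" using J j indep_subset[of J] by blast
      then have "j \<notin> cl B" using indep_insertD j by blast
      then have "j \<in> X" using e j J by auto
      then have "card (insert j B) \<le> rk X" using Ij assms by (intro card_le_rk) auto
      then show False using j assms indep_finite by simp
    qed
  qed
qed

lemma cl_mono:
  assumes "X \<subseteq> Y"
  shows "cl X \<subseteq> cl Y"
proof
  fix e assume e: "e \<in> cl X"
  obtain B where B: "B \<subseteq> X" "I B" "card B = rk X" using basis_exists by blast
  obtain B' where B': "B \<subseteq> B'" "B' \<subseteq> Y" "I B'" "card B' = rk Y"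
    using basis_extend[of B Y] B assms by blast
  have eB: "e \<in> cl B" using e cl_basis[OF B] by simp
  show "e \<in> cl Y"
  proof (rule ccontr)
    assume "e \<notin> cl Y"
    then have n: "e \<notin> cl B'" using cl_basis B' by simp
    have "e \<in> E" using e by (simp add: in_cl)
    then have "I (insert e B')" using n B' indep_insert by simp
    then have "I (insert e B)" using B' indep_subset by (meson insert_mono)
    moreover have "e \<notin> B" using n B' cl_increasing[OF indep_subset_ground, of B'] by blast
    ultimately show False using eB indep_insertD by blast
  qed
qed

lemma rk_cl_eq_card_basis:
  assumes "X \<subseteq> E" "B \<subseteq> X" "I B" "card B = rk X"
  shows "rk (cl X) = card B"
proof -
  have "B \<subseteq> cl X" using assms cl_increasing by blast
  then obtain J where J: "B \<subseteq> J" "J \<subseteq> cl X" "I J" "card J = rk (cl X)"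
    using basis_extend assms by blast
  have "J \<subseteq> B"
  proof
    fix j assume "j \<in> J"
    then have "j \<in> cl B" "I (insert j B)"
      using J cl_basis[OF assms(2-4)] indep_subset[of J "insert j B"] by blast+
    then show "j \<in> B" using indep_insertD by blast
  qed
  with J show ?thesis by (simp add: subset_antisym)
qed

lemma rk_cl:
  assumes "X \<subseteq> E"
  shows "rk (cl X) = rk X"
proof -
  obtain B where B: "B \<subseteq> X" "I B" "card B = rk X" using basis_exists by blast
  with rk_cl_eq_card_basis[OF assms B] show ?thesis by simp
qed

lemma cl_idem:
  assumes "X \<subseteq> E"
  shows "cl (cl X) = cl X"
proof -
  obtain B where B: "B \<subseteq> X" "I B" "card B = rk X" using basis_exists by blast
  then have "cl (cl X) = cl B"
    using assms cl_increasing[of X] rk_cl[of X] by (intro cl_basis) auto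
  with cl_basis[OF B] show ?thesis by simp
qed

text \<open>The Mac Lane-Steinitz exchange property.\<close>

lemma cl_exchange:
  assumes "y \<in> cl (insert x X)" "y \<notin> cl X" "x \<in> E"
  shows "x \<in> cl (insert y X)"
proof -
  have "rk (insert y X) = Suc (rk X)"
    using assms by (intro rk_insert_not_in_cl) (auto simp: in_cl)
  moreover have "rk (insert x (insert y X)) \<le> Suc (rk X)"
    using assms rk_insert_le[of x X] by (simp add: in_cl insert_commute)
  ultimately show ?thesis
    using rk_mono[OF subset_insertI, of "insert y X" x] assms(3) by (auto simp: in_cl)
qed

lemma flD: "fl F \<Longrightarrow> F \<subseteq> E" "fl F \<Longrightarrow> cl F = F"
  by (auto simp: flat_def)

lemma fl_finite: "fl F \<Longrightarrow> finite F"
  using flD(1) finite_ground finite_subset by blast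

lemma fl_cl: "X \<subseteq> E \<Longrightarrow> fl (cl X)"
  by (simp add: flat_def cl_subset_ground cl_idem)

lemma cl_subset_fl: "fl F \<Longrightarrow> X \<subseteq> F \<Longrightarrow> cl X \<subseteq> F"
  using cl_mono flD by blast

lemma cl_subset_cl: "Y \<subseteq> E \<Longrightarrow> X \<subseteq> cl Y \<Longrightarrow> cl X \<subseteq> cl Y"
  using cl_subset_fl fl_cl by blast

lemma fl_Int: "fl F \<Longrightarrow> fl G \<Longrightarrow> fl (F \<inter> G)"
proof -
  assume a: "fl F" "fl G"
  have "cl (F \<inter> G) \<subseteq> F \<inter> G" using a cl_subset_fl by blast
  moreover have "F \<inter> G \<subseteq> E" using a flD by blast
  ultimately show ?thesis using cl_increasing by (auto simp: flat_def)
qed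

lemma fl_ground: "fl E"
  using cl_subset_ground cl_increasing[of E] by (auto simp: flat_def)

lemma subset_cl_if_rk:
  assumes "A \<subseteq> B" "B \<subseteq> E" "rk B \<le> rk A"
  shows "B \<subseteq> cl A"
proof
  fix e assume e: "e \<in> B"
  have "rk (insert e A) \<le> rk B" using assms e by (intro rk_mono) auto
  with rk_mono[OF subset_insertI, of A e] assms e show "e \<in> cl A" by (auto simp: in_cl)
qed

lemma fl_eq_if_rk: "fl F \<Longrightarrow> G \<subseteq> E \<Longrightarrow> F \<subseteq> G \<Longrightarrow> rk G \<le> rk F \<Longrightarrow> F = G"
  using subset_cl_if_rk[of F G] flD by blast

lemma rk_insert_fl: "fl F \<Longrightarrow> x \<in> E \<Longrightarrow> x \<notin> F \<Longrightarrow> rk (insert x F) = Suc (rk F)"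
  using rk_insert_not_in_cl[of x F] flD by simp

section \<open>Circuits, points and lines\<close>

lemma dependent_contains_circuit:
  assumes "X \<subseteq> E" "\<not> I X"
  shows "\<exists>C. C \<subseteq> X \<and> circuit E I C"
  using finite_subset[OF assms(1) finite_ground] assms
proof (induction X rule: finite_psubset_induct)
  case (psubset X)
  show ?case
  proof (cases "\<forall>x\<in>X. I (X - {x})")
    case True
    then show ?thesis using psubset unfolding circuit_def by blast
  next
    case False
    then obtain x where "x \<in> X" "\<not> I (X - {x})" by blast
    then show ?thesis using psubset.IH[of "X - {x}"] psubset.prems by blast
  qed
qed

lemma indep_if_card_le_2:
  assumes "X \<subseteq> E" "card X \<le> 2"
  shows "I X"
proof (rule ccontr)
  assume "\<not> I X"
  then obtain C where "C \<subseteq> X" "circuit E I C" using dependent_contains_circuit assms by blast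
  then have "card C \<le> card X" "card C \<ge> 3"
    using assms finite_ground simple finite_subset[of X E]
    by (auto simp: simple_def intro: card_mono)
  with assms show False by simp
qed

lemma indep_pair: "x \<in> E \<Longrightarrow> y \<in> E \<Longrightarrow> I {x, y}"
  by (rule indep_if_card_le_2) (auto simp: card_insert_if)

lemma cl_empty: "cl {} = {}"
  using indep_insertD[of _ "{}"] indep_pair by (fastforce dest: subsetD[OF cl_subset_ground])

lemma not_in_cl_singleton: "x \<in> E \<Longrightarrow> y \<in> E \<Longrightarrow> x \<noteq> y \<Longrightarrow> y \<notin> cl {x}"
  using indep_insertD[of y "{x}"] indep_pair by auto

lemma cl_singleton: "x \<in> E \<Longrightarrow> cl {x} = {x}"
  using not_in_cl_singleton cl_increasing[of "{x}"] cl_subset_ground by blast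

text \<open>Exchange on a line: since \<open>z\<close> and \<open>y\<close> are distinct points of a
  simple matroid, \<open>z\<close> is not in the closure of \<open>y\<close> alone.\<close>

lemma line_exchange:
  assumes "z \<in> cl {x, y}" "x \<in> E" "y \<in> E" "z \<noteq> y"
  shows "x \<in> cl {y, z}"
proof -
  have "z \<in> E" using assms cl_subset_ground by blast
  then have "z \<notin> cl {y}" using not_in_cl_singleton assms by blast
  then show ?thesis using cl_exchange[of z x "{y}"] assms by (simp add: insert_commute)
qed

lemma line_exchange':
  assumes "z \<in> cl {x, y}" "x \<in> E" "y \<in> E" "z \<noteq> x"
  shows "y \<in> cl {x, z}"
  using line_exchange[of z y x] assms by (simp add: insert_commute)

subsection \<open>Hyperplanes of flats\<close>

text \<open>Hyperplanes of the restriction to the flat \<open>G\<close>; the sets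
  \<open>G - H\<close> are the cocircuits of that restriction.\<close>

definition hyp :: "'a set \<Rightarrow> 'a set \<Rightarrow> bool" where
  "hyp H G \<longleftrightarrow> fl H \<and> fl G \<and> H \<subseteq> G \<and> rk G = Suc (rk H)"

lemma hyp_nonempty_diff: "hyp H G \<Longrightarrow> G - H \<noteq> {}"
  by (auto simp: hyp_def dest: rk_mono)

lemma hyp_cl_insert:
  assumes "hyp H G" "x \<in> G" "x \<notin> H"
  shows "cl (insert x H) = G"
proof -
  have G: "insert x H \<subseteq> G" "G \<subseteq> E" using assms flD by (auto simp: hyp_def)
  moreover have "rk (insert x H) = rk G"
    using assms G rk_insert_fl[of H x] by (auto simp: hyp_def)
  ultimately show ?thesis
    using subset_cl_if_rk[of "insert x H" G] cl_subset_fl[of G "insert x H"] assms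
    by (auto simp: hyp_def)
qed

lemma cl_insert_hyp: "fl H \<Longrightarrow> x \<in> E \<Longrightarrow> x \<notin> H \<Longrightarrow> hyp H (cl (insert x H))"
  using flD[of H] cl_increasing[of "insert x H"] rk_cl[of "insert x H"] rk_insert_fl[of H x]
    fl_cl[of "insert x H"]
  by (auto simp: hyp_def)

lemma hyp_maximal:
  assumes "hyp H G" "fl F" "H \<subseteq> F" "F \<subset> G"
  shows "F = H"
proof -
  have "fl G" using assms by (simp add: hyp_def)
  then have "rk F < rk G" using fl_eq_if_rk[of F G] assms flD(1)[of G] by fastforce
  then show ?thesis using fl_eq_if_rk[of H F] assms flD[of F] by (auto simp: hyp_def)
qed

text \<open>Extend a basis of \<open>K\<close> by one element \<open>b\<close> to a basis of \<open>G\<close> and then to one of \<open>F\<close>;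
  dropping \<open>b\<close> spans the required hyperplane.\<close>

lemma hyp_extend:
  assumes "hyp K G" "fl F" "G \<subseteq> F"
  obtains L where "hyp L F" "K \<subseteq> L" "L \<inter> G = K"
proof -
  have K: "fl K" "fl G" "K \<subseteq> G" "rk G = Suc (rk K)" using assms by (auto simp: hyp_def)
  obtain B where B: "B \<subseteq> K" "I B" "card B = rk K" using basis_exists by blast
  obtain b where b: "b \<in> G" "b \<notin> K" using hyp_nonempty_diff assms by blast
  have bE: "b \<in> E" using b K flD by blast
  have clB: "cl B = K" using cl_basis[OF B] flD K by simp
  then have "I (insert b B)" using indep_insert B b bE by simp
  moreover have "insert b B \<subseteq> F" using B b K assms by blast
  ultimately obtain D where D: "insert b B \<subseteq> D" "D \<subseteq> F" "I D" "card D = rk F"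
    using basis_extend by blast
  define L where "L = cl (D - {b})"
  have ID: "I (D - {b})" by (rule indep_subset[OF D(3)]) auto
  have bL: "b \<notin> L" using indep_insertD[of b "D - {b}"] D by (auto simp: L_def insert_absorb)
  have flL: "fl L" unfolding L_def using indep_subset_ground[OF ID] by (rule fl_cl)
  have "rk L = card (D - {b})"
    using rk_cl[of "D - {b}"] rk_indep[OF ID] indep_subset_ground[OF ID] by (simp add: L_def)
  moreover have "Suc (card (D - {b})) = card D"
    using D(1) card_Suc_Diff1[OF indep_finite[OF D(3)]] by auto
  moreover have "L \<subseteq> F" unfolding L_def using D assms by (intro cl_subset_fl) auto
  ultimately have h: "hyp L F" using flL assms D by (auto simp: hyp_def)
  have KL: "K \<subseteq> L" using b B D unfolding clB[symmetric] L_def by (intro cl_mono) auto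
  have "L \<inter> G = K"
    using KL K flL b bL by (intro hyp_maximal[OF assms(1)] fl_Int) auto
  with h KL that show ?thesis by blast
qed

lemma hyp_exists:
  assumes "fl F" "rk F = Suc n"
  obtains H where "hyp H F"
proof -
  obtain B where B: "B \<subseteq> F" "I B" "card B = rk F" using basis_exists by blast
  then obtain b where b: "b \<in> B" using assms by fastforce
  have ID: "I (B - {b})" by (rule indep_subset[OF B(2)]) auto
  have sE: "B - {b} \<subseteq> E" using ID indep_subset_ground by blast
  have "hyp (cl (B - {b})) F"
    unfolding hyp_def using fl_cl[OF sE] rk_cl[OF sE] rk_indep[OF ID] B b assms
      cl_subset_fl[of F "B - {b}"] card_Suc_Diff1[OF indep_finite[OF B(2)] b] by auto
  with that show ?thesis by blast
qed

text \<open>A basis of \<open>G\<close> containing \<open>x\<close> and \<open>y\<close>, with all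
  other elements in \<open>H\<close>, loses two elements when both are dropped; the rest spans a
  hyperplane of \<open>H\<close>, and independence keeps \<open>y\<close> out of its span with
  \<open>x\<close>.\<close>

lemma separating_hyp:
  assumes "hyp H G" "x \<in> G - H" "y \<in> G - H" "x \<noteq> y"
  obtains H' where "hyp H' H" "y \<notin> cl (insert x H')"
proof -
  have HG: "fl H" "fl G" "H \<subseteq> G" "rk G = Suc (rk H)" using assms by (auto simp: hyp_def)
  have xy: "x \<in> E" "y \<in> E" "H \<subseteq> E" using assms HG flD by blast+
  obtain B where B: "{x, y} \<subseteq> B" "B \<subseteq> insert x (insert y H)" "I B"
    "card B = rk (insert x (insert y H))"
    using basis_extend[of "{x,y}" "insert x (insert y H)"] indep_pair xy by blast
  have "rk G \<le> rk (insert x (insert y H))"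
    using rk_insert_fl[of H x] xy assms HG rk_mono[of "insert x H" "insert x (insert y H)"] by auto
  moreover have "rk (insert x (insert y H)) \<le> rk G" using assms HG by (intro rk_mono) auto
  ultimately have cB: "card B = rk G" using B by simp
  define D where "D = B - {x, y}"
  have ID: "I D" unfolding D_def by (rule indep_subset[OF B(3)]) auto
  have DH: "D \<subseteq> H" using B by (auto simp: D_def)
  have DE: "D \<subseteq> E" using ID indep_subset_ground by blast
  have "B = insert x (insert y D)" "x \<notin> insert y D" "y \<notin> D"
    using B(1) assms(4) by (auto simp: D_def)
  then have "card B = Suc (Suc (card D))" using indep_finite[OF ID] by simp
  then have "hyp (cl D) H"
    unfolding hyp_def using fl_cl[OF DE] rk_cl[OF DE] rk_indep[OF ID] HG cB
      cl_subset_fl[of H D] DH by auto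
  moreover have "y \<notin> cl (insert x (cl D))"
  proof -
    have "insert y (insert x D) = B" using B by (auto simp: D_def)
    then have "y \<notin> cl (insert x D)"
      using indep_insertD[of y "insert x D"] B assms(4) by (auto simp: D_def)
    moreover have "insert x (cl D) \<subseteq> cl (insert x D)"
      using cl_mono[of D "insert x D"] cl_increasing[of "insert x D"] xy DE by auto
    ultimately show ?thesis using cl_subset_cl[of "insert x D" "insert x (cl D)"] xy DE by blast
  qed
  ultimately show ?thesis using that by blast
qed

text \<open>The hyperplanes of \<open>G\<close> through the corank-two flat \<open>H'\<close> form a
  pencil. The member spanned by \<open>x\<close> meets \<open>H\<close> only in \<open>H'\<close>,
  because it covers \<open>H'\<close> and \<open>x\<close> is outside \<open>H\<close>.\<close>

lemma hyp_pencil: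
  assumes "hyp H' H" "hyp H G" "x \<in> G - H"
  shows "hyp (cl (insert x H')) G" "cl (insert x H') \<inter> H = H'" "hyp H' (cl (insert x H'))"
proof -
  have H: "fl H'" "fl H" "fl G" "H' \<subseteq> H" "H \<subseteq> G" "rk G = Suc (rk H)" "rk H = Suc (rk H')"
    using assms by (auto simp: hyp_def)
  have xE: "x \<in> E" using assms H flD by blast
  show h: "hyp H' (cl (insert x H'))" using cl_insert_hyp H xE assms by blast
  then show "hyp (cl (insert x H')) G"
    using H assms cl_subset_fl[of G "insert x H'"] by (auto simp: hyp_def)
  have "x \<in> cl (insert x H')" using cl_increasing[of "insert x H'"] xE H flD by blast
  then show "cl (insert x H') \<inter> H = H'"
    using h H assms by (intro hyp_maximal[OF h] fl_Int) (auto simp: hyp_def)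
qed

text \<open>A common point outside \<open>H\<close> would span both members of the pencil together
  with \<open>H'\<close>, so the members would coincide and contain \<open>y\<close>.\<close>

lemma hyp_pencil_disjoint:
  assumes "hyp H' H" "hyp H G" "x \<in> G - H" "y \<in> G - H" "y \<notin> cl (insert x H')"
  shows "(cl (insert x H') - H) \<inter> (cl (insert y H') - H) = {}"
proof (rule ccontr)
  assume "\<not> ?thesis"
  then obtain z where z: "z \<in> cl (insert x H')" "z \<in> cl (insert y H')" "z \<notin> H" by blast
  have "z \<notin> H'" using z assms by (auto simp: hyp_def)
  then have "cl (insert z H') = cl (insert x H')" "cl (insert z H') = cl (insert y H')"
    using hyp_cl_insert hyp_pencil(3)[OF assms(1,2)] assms z by blast+
  moreover have "y \<in> cl (insert y H')"
    using cl_increasing[of "insert y H'"] assms flD by (auto simp: hyp_def)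
  ultimately show False using assms by simp
qed

subsection \<open>Large cocircuits\<close>

text \<open>Passing to the smaller of two flats through a separating hyperplane halves the cocircuit
  \<open>G - H\<close> at the cost of one rank, until a coloop remains.\<close>

lemma hyp_with_coloop:
  assumes "hyp H G" "card (G - H) < 2 ^ Suc j"
  shows "\<exists>K L. hyp K L \<and> L \<subseteq> G \<and> card (L - K) = 1 \<and> rk G \<le> rk L + j"
  using assms
proof (induction j arbitrary: H G)
  case 0
  have "finite (G - H)" using 0 fl_finite by (auto simp: hyp_def)
  then have "card (G - H) = 1"
    using 0 hyp_nonempty_diff[OF 0(1)] card_gt_0_iff[of "G - H"] by simp
  then show ?case using 0 by auto
next
  case (Suc j)
  have fin: "finite (G - H)" using Suc(2) fl_finite by (auto simp: hyp_def)
  show ?case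
  proof (cases "card (G - H) = 1")
    case True
    then show ?thesis using Suc(2) by (intro exI[of _ H] exI[of _ G]) auto
  next
    case False
    obtain x where x: "x \<in> G - H" using hyp_nonempty_diff[OF Suc(2)] by blast
    obtain y where y: "y \<in> G - H" "y \<noteq> x"
      using False x by (metis is_singletonI' is_singleton_altdef empty_iff)
    obtain H' where H': "hyp H' H" "y \<notin> cl (insert x H')"
      using separating_hyp[OF Suc(2) x y(1)] y by metis
    \<comment> \<open>The two pieces cut out by \<open>x\<close> and \<open>y\<close> are disjoint
      subsets of a set with fewer than \<open>2 * 2 ^ Suc j\<close> elements, so one of them is
      small enough.\<close>
    have half: "\<exists>z\<in>G - H. card (cl (insert z H') - H) < 2 ^ Suc j"
    proof (rule ccontr)
      assume n: "\<not> ?thesis"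
      have s: "cl (insert z H') - H \<subseteq> G - H" if "z \<in> G - H" for z
        using hyp_pencil(1)[OF H'(1) Suc(2) that] by (auto simp: hyp_def)
      have "card (cl (insert x H') - H) + card (cl (insert y H') - H) \<le> card (G - H)"
        using hyp_pencil_disjoint[OF H'(1) Suc(2) x y(1) H'(2)] s x y fin
        by (subst card_Un_disjoint[symmetric]) (auto intro!: card_mono finite_subset[OF s fin])
      moreover have "2 ^ Suc j \<le> card (cl (insert x H') - H)"
        "2 ^ Suc j \<le> card (cl (insert y H') - H)"
        using n x y by (auto simp: not_less)
      ultimately show False using Suc(3) by simp
    qed
    then obtain z where z: "z \<in> G - H" "card (cl (insert z H') - H) < 2 ^ Suc j" by blast
    note p = hyp_pencil[OF H'(1) Suc(2) z(1)]
    \<comment> \<open>The recursion needs a cocircuit of the smaller flat, which is its complement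
      of \<open>H'\<close>; this is the same set as the piece just counted.\<close>
    have "cl (insert z H') - H' = cl (insert z H') - H" using p by blast
    then obtain K L where "hyp K L" "L \<subseteq> cl (insert z H')" "card (L - K) = 1"
      "rk (cl (insert z H')) \<le> rk L + j"
      using Suc(1)[OF p(3)] z by auto
    moreover have "rk G = Suc (rk (cl (insert z H')))" "cl (insert z H') \<subseteq> G"
      using p by (auto simp: hyp_def)
    ultimately show ?thesis by (metis Suc_le_mono add_Suc_right order_trans)
  qed
qed

text \<open>Induction on \<open>t\<close>: \<open>hyp_with_coloop\<close> gives a flat
  \<open>L\<close> with a coloop \<open>e\<close>, whose complement \<open>K\<close> has lost at
  most \<open>d\<close> ranks compared with \<open>F\<close>. A claw inside \<open>K\<close> stays a
  claw when \<open>e\<close> is added.\<close>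

lemma claw_if_small_cocircuits:
  assumes "fl F" "\<And>H. hyp H F \<Longrightarrow> card (F - H) < 2 ^ d" "t * d < rk F"
  shows "\<exists>X\<subseteq>F. claw E I X \<and> card X = Suc t"
  using assms
proof (induction t arbitrary: F)
  case 0
  then obtain x where x: "x \<in> F" using rk_empty by (cases "F = {}") auto
  then have "x \<in> E" using 0 flD by blast
  then have "claw E I {x}"
    using cl_singleton indep_pair[of x x] by (auto simp: claw_def flat_def)
  then show ?case using x by (intro exI[of _ "{x}"]) auto
next
  case (Suc t)
  obtain H where H: "hyp H F" using hyp_exists[OF Suc(2)] Suc(4) by (metis Suc_pred less_nat_zero_code neq0_conv)
  have "finite (F - H)" using Suc(2) fl_finite by blast
  then have "card (F - H) > 0" using hyp_nonempty_diff[OF H] card_gt_0_iff by blast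
  then obtain j where j: "d = Suc j" using Suc(3)[OF H] by (cases d) auto
  obtain K L where KL: "hyp K L" "L \<subseteq> F" "card (L - K) = 1" "rk F \<le> rk L + j"
    using hyp_with_coloop[OF H] Suc(3)[OF H] j by blast
  have K: "fl K" "fl L" "K \<subseteq> L" "rk L = Suc (rk K)" using KL by (auto simp: hyp_def)
  have "\<exists>X\<subseteq>K. claw E I X \<and> card X = Suc t"
  proof (rule Suc.IH[OF K(1)])
    fix H' assume H': "hyp H' K"
    \<comment> \<open>Each cocircuit of \<open>K\<close> is the trace of a cocircuit of
      \<open>F\<close>, so it inherits the size bound.\<close>
    obtain M where M: "hyp M F" "M \<inter> K = H'"
      using hyp_extend[OF H' Suc(2)] KL K by blast
    then have "card (K - H') \<le> card (F - M)"
      using KL K Suc(2) fl_finite by (intro card_mono) auto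
    then show "card (K - H') < 2 ^ d" using Suc(3)[OF M(1)] by simp
  next
    show "t * d < rk K" using Suc(4) KL K j by simp
  qed
  then obtain X where X: "X \<subseteq> K" "fl X" "I X" "card X = Suc t" by (auto simp: claw_def)
  obtain e where e: "L - K = {e}" using KL(3) card_1_singletonE by blast
  have eE: "e \<in> E" "e \<in> L" "e \<notin> K" using e K flD by blast+
  have XE: "insert e X \<subseteq> E" using eE X flD by blast
  \<comment> \<open>A further point \<open>z\<close> of this closure would lie in \<open>K\<close>,
    and exchange would then place the coloop \<open>e\<close> in \<open>K\<close> as well.\<close>
  have "cl (insert e X) \<subseteq> insert e X"
  proof
    fix z assume z: "z \<in> cl (insert e X)"
    have zL: "z \<in> L" using z cl_subset_fl[OF K(2), of "insert e X"] X K eE by blast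
    show "z \<in> insert e X"
    proof (rule ccontr)
      assume n: "z \<notin> insert e X"
      then have "z \<in> K" using zL e by blast
      moreover have "e \<in> cl (insert z X)" using cl_exchange[OF z] n X flD eE by auto
      ultimately show False using cl_subset_fl[OF K(1), of "insert z X"] X eE by blast
    qed
  qed
  then have "fl (insert e X)" using cl_increasing[OF XE] XE by (auto simp: flat_def)
  moreover have "I (insert e X)" using indep_insert[OF X(3) eE(1)] flD(2)[OF X(2)] X(1) eE(3) by auto
  moreover have "card (insert e X) = Suc (Suc t)" using X eE(3) fl_finite[OF X(2)] by (subst card_insert_disjoint) auto
  moreover have "insert e X \<subseteq> F" using X eE K KL by blast
  ultimately show ?case by (metis claw_def)
qed

subsection \<open>Binary projective geometries\<close>

text \<open>For points of the ground set this says that no two points of \<open>P\<close> form a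
  claw.\<close>

definition thick :: "'a set \<Rightarrow> bool" where
  "thick P \<longleftrightarrow> (\<forall>x\<in>P. \<forall>y\<in>P. x \<noteq> y \<longrightarrow> (\<exists>z\<in>cl {x, y}. z \<noteq> x \<and> z \<noteq> y))"

text \<open>A coordinate-free form of the binary projective geometry of rank \<open>k\<close>: by
  \<open>card_thick\<close> a thick flat of rank \<open>k\<close> has at least
  \<open>2 ^ k - 1\<close> points, and equality forces it to be binary, as
  \<open>pg_representation\<close> shows. A point and the empty flat are the cases of rank 1 and
  0.\<close>

definition pg :: "'a set \<Rightarrow> nat \<Rightarrow> bool" where
  "pg P k \<longleftrightarrow> fl P \<and> rk P = k \<and> card P = 2 ^ k - 1 \<and> thick P"

lemma thick_subset: "thick P \<Longrightarrow> Q \<subseteq> P \<Longrightarrow> thick Q"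
  by (auto simp: thick_def subset_iff)

lemma thickD:
  assumes "thick P" "x \<in> P" "y \<in> P" "x \<noteq> y"
  obtains z where "z \<in> cl {x, y}" "z \<noteq> x" "z \<noteq> y"
  using assms by (auto simp: thick_def)

text \<open>Choose a third point on each line from \<open>e\<close> to a point of \<open>Q\<close>.
  Equal choices for two points \<open>q\<close>, \<open>q'\<close> would put \<open>e\<close> on the
  line through them, hence into \<open>Q\<close>.\<close>

lemma third_points:
  assumes "hyp Q P" "thick P" "e \<in> P - Q"
  obtains g where "inj_on g Q" "g ` Q \<subseteq> P - Q - {e}" "\<And>q. q \<in> Q \<Longrightarrow> g q \<in> cl {e, q}"
proof -
  have Q: "fl Q" "fl P" "Q \<subseteq> P" "P \<subseteq> E" using assms flD by (auto simp: hyp_def)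
  have "\<forall>q\<in>Q. \<exists>z. z \<in> cl {e, q} \<and> z \<noteq> e \<and> z \<noteq> q"
  proof
    fix q assume "q \<in> Q"
    then have "q \<in> P" "e \<in> P" "e \<noteq> q" using assms Q by auto
    then show "\<exists>z. z \<in> cl {e, q} \<and> z \<noteq> e \<and> z \<noteq> q" using thickD[OF assms(2)] by metis
  qed
  then obtain g where g: "\<And>q. q \<in> Q \<Longrightarrow> g q \<in> cl {e, q} \<and> g q \<noteq> e \<and> g q \<noteq> q" by metis
  have eE: "e \<in> E" "e \<notin> Q" using assms Q by auto
  have QE: "q \<in> E" if "q \<in> Q" for q using that Q by blast
  have no: "e \<notin> cl {q, q'}" if "q \<in> Q" "q' \<in> Q" for q q'
    using cl_subset_fl[OF Q(1), of "{q, q'}"] that eE by auto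
  have "inj_on g Q"
  proof (rule inj_onI, rule ccontr)
    fix q q' assume q: "q \<in> Q" "q' \<in> Q" "g q = g q'" "q \<noteq> q'"
    have "q \<in> cl {e, g q}"
      using line_exchange'[of "g q" e q] g[OF q(1)] eE QE[OF q(1)] by blast
    moreover have "cl {e, g q} \<subseteq> cl {e, q'}"
      using g q eE QE cl_increasing[of "{e, q'}"] by (intro cl_subset_cl) auto
    ultimately have "e \<in> cl {q', q}" using line_exchange[of q e q'] q eE QE by auto
    then show False using no q by blast
  qed
  moreover have "g q \<in> P - Q - {e}" if "q \<in> Q" for q
  proof -
    have "g q \<in> P" using cl_subset_fl[OF Q(2), of "{e, q}"] g that assms Q by auto
    moreover have "g q \<notin> Q"
      using line_exchange[of "g q" e q] g[OF that] eE QE[OF that] no that by blast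
    ultimately show ?thesis using g that by blast
  qed
  ultimately show ?thesis using that[of g] g by blast
qed

text \<open>The points are those of \<open>Q\<close>, one point \<open>e\<close> outside, and the
  distinct third points on the lines from \<open>e\<close> to \<open>Q\<close>.\<close>

lemma card_thick_hyp:
  assumes "hyp Q P" "thick P"
  shows "2 * card Q + 1 \<le> card P"
proof -
  obtain e where e: "e \<in> P - Q" using hyp_nonempty_diff assms by blast
  obtain g where g: "inj_on g Q" "g ` Q \<subseteq> P - Q - {e}"
    using third_points[OF assms e] by metis
  have fin: "finite P" "finite Q" "Q \<subseteq> P" using assms fl_finite by (auto simp: hyp_def)
  have "card Q \<le> card (P - Q - {e})" using card_mono[OF _ g(2)] card_image[OF g(1)] fin by simp
  moreover have "card (P - Q - {e}) = card P - card Q - 1" "card P - card Q > 0"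
    using fin e card_Diff_subset[of Q P] card_gt_0_iff[of "P - Q"] by auto
  ultimately show ?thesis by linarith
qed

lemma card_thick:
  assumes "fl P" "thick P"
  shows "2 ^ rk P \<le> Suc (card P)"
  using assms
proof (induction "rk P" arbitrary: P)
  case (Suc n)
  obtain Q where Q: "hyp Q P" using hyp_exists[OF Suc(3)] Suc(2) by metis
  have "2 ^ rk Q \<le> Suc (card Q)"
    using Suc Q thick_subset by (intro Suc(1)) (auto simp: hyp_def)
  then show ?case using card_thick_hyp[OF Q Suc(4)] Q by (auto simp: hyp_def)
qed auto

text \<open>The size of \<open>P\<close> is the minimum possible, so both \<open>card_thick\<close>
  for \<open>Q\<close> and \<open>card_thick_hyp\<close> hold with equality.\<close>

lemma pg_hyp_card:
  assumes "pg P k" "hyp Q P"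
  shows "k = Suc (rk Q)" "Suc (card Q) = 2 ^ rk Q" "card P = Suc (2 * card Q)"
proof -
  show k: "k = Suc (rk Q)" using assms by (auto simp: pg_def hyp_def)
  have "thick Q" "fl Q" using assms thick_subset by (auto simp: pg_def hyp_def)
  then have "2 ^ rk Q \<le> Suc (card Q)" using card_thick by blast
  moreover have "2 * card Q + 1 \<le> card P" using card_thick_hyp[OF assms(2)] assms(1) by (auto simp: pg_def)
  moreover have "card P = 2 * 2 ^ rk Q - 1" using assms k by (auto simp: pg_def)
  ultimately show "Suc (card Q) = 2 ^ rk Q" "card P = Suc (2 * card Q)" by linarith+
qed

text \<open>By the count in \<open>pg_hyp_card\<close>, the third points on the lines from
  \<open>x\<close> to \<open>Q\<close> exhaust \<open>P - Q - {x}\<close>. If \<open>z\<close> were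
  outside \<open>Q\<close>, then \<open>y\<close> and \<open>z\<close> would arise from distinct
  points of \<open>Q\<close> on one line with \<open>x\<close>, which would put \<open>x\<close>
  into \<open>Q\<close>.\<close>

lemma pg_third_in_hyp:
  assumes "pg P k" "hyp Q P" "x \<in> P - Q" "y \<in> P - Q" "x \<noteq> y"
    and z: "z \<in> cl {x, y}" "z \<noteq> x" "z \<noteq> y"
  shows "z \<in> Q"
proof (rule ccontr)
  assume zQ: "z \<notin> Q"
  have P: "fl P" "fl Q" "thick P" "Q \<subseteq> P" "P \<subseteq> E" using assms flD by (auto simp: pg_def hyp_def)
  have fin: "finite P" "finite Q" using P fl_finite by auto
  obtain g where g: "inj_on g Q" "g ` Q \<subseteq> P - Q - {x}" "\<And>q. q \<in> Q \<Longrightarrow> g q \<in> cl {x, q}"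
    using third_points[OF assms(2) P(3) assms(3)] by metis
  have "card (P - Q - {x}) = card P - card Q - 1"
    using fin assms(3) card_Diff_subset[of Q P] P by simp
  then have "card (g ` Q) = card (P - Q - {x})"
    using pg_hyp_card[OF assms(1,2)] card_image[OF g(1)] by simp
  then have gQ: "g ` Q = P - Q - {x}" using card_subset_eq[OF _ g(2)] fin by simp
  have "z \<in> P" using cl_subset_fl[OF P(1), of "{x, y}"] assms by auto
  then have "y \<in> g ` Q" "z \<in> g ` Q" unfolding gQ using zQ z assms(4,5) by auto
  then obtain q q' where q: "q \<in> Q" "q' \<in> Q" "y = g q" "z = g q'" by auto
  have E: "q \<in> E" "q' \<in> E" "x \<in> E" "y \<in> E" using q P assms by auto
  have "q' \<in> cl {x, z}"
    using line_exchange'[of z x q'] g(3)[OF q(2)] q z E by blast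
  moreover have "y \<in> cl {x, q}" using g(3) q by blast
  then have xy: "cl {x, y} \<subseteq> cl {x, q}"
    using E cl_increasing[of "{x, q}"] by (intro cl_subset_cl) auto
  then have "cl {x, z} \<subseteq> cl {x, q}"
    using z E cl_increasing[of "{x, q}"] by (intro cl_subset_cl) auto
  ultimately have "q' \<in> cl {x, q}" by blast
  moreover have "q' \<noteq> q" using q z by blast
  ultimately have "x \<in> cl {q, q'}" using line_exchange E by blast
  moreover have "cl {q, q'} \<subseteq> Q" using q by (intro cl_subset_fl[OF P(2)]) auto
  ultimately show False using assms by blast
qed

text \<open>For \<open>e\<close> outside \<open>B\<close> this set is the fundamental circuit of
  \<open>e\<close> without \<open>e\<close>. A minimal subset of \<open>B\<close> spanning
  \<open>e\<close> is contained in it: by exchange, none of its elements can be avoided.\<close>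

lemma in_cl_fundamental_circuit:
  assumes "I B" "e \<in> cl B"
  shows "e \<in> cl {b \<in> B. e \<notin> cl (B - {b})}"
proof -
  let ?S = "{D. D \<subseteq> B \<and> e \<in> cl D}"
  have "finite ?S" "?S \<noteq> {}" using indep_finite[OF assms(1)] assms(2) by auto
  from finite_has_minimal[OF this] obtain D where D: "D \<subseteq> B" "e \<in> cl D"
    and min: "\<And>D'. D' \<subseteq> B \<Longrightarrow> e \<in> cl D' \<Longrightarrow> D' \<subseteq> D \<Longrightarrow> D = D'"
    by auto
  have "D \<subseteq> {b \<in> B. e \<notin> cl (B - {b})}"
  proof clarify
    fix b assume b: "b \<in> D"
    have "e \<notin> cl (B - {b})"
    proof
      assume e: "e \<in> cl (B - {b})"
      have n: "e \<notin> cl (D - {b})" using min[of "D - {b}"] D b by blast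
      have BE: "B \<subseteq> E" using assms indep_subset_ground by blast
      have "e \<in> cl (insert b (D - {b}))" using D b by (simp add: insert_absorb)
      then have "b \<in> cl (insert e (D - {b}))" using cl_exchange n b D BE by blast
      moreover have "cl (insert e (D - {b})) \<subseteq> cl (B - {b})"
        using e D BE cl_increasing[of "B - {b}"] by (intro cl_subset_cl) auto
      moreover have "b \<notin> cl (B - {b})"
        using indep_insertD[of b "B - {b}"] assms b D by (auto simp: insert_absorb)
      ultimately show False by blast
    qed
    then show "b \<in> B \<and> e \<notin> cl (B - {b})" using b D by blast
  qed
  then show ?thesis using D cl_mono by blast
qed

section \<open>Coordinates over GF(2)\<close>

text \<open>The \<open>i\<close>-th coordinate of a point records whether it avoids the hyperplane
  spanned by a basis without its \<open>i\<close>-th element. Additivity on lines is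
  \<open>pg_third_in_hyp\<close>; injectivity holds because the third point on a line through two
  points with equal coordinates would have none, and counting gives surjectivity.\<close>

lemma pg_coordinates:
  assumes "pg P k"
  obtains \<phi> where "bij_betw \<phi> P (Pow {0..<k} - {{}})"
    "\<And>x y z i. x \<in> P \<Longrightarrow> y \<in> P \<Longrightarrow> x \<noteq> y \<Longrightarrow> z \<in> cl {x, y} \<Longrightarrow> z \<noteq> x \<Longrightarrow> z \<noteq> y \<Longrightarrow>
       i \<in> \<phi> z \<longleftrightarrow> (i \<in> \<phi> x) \<noteq> (i \<in> \<phi> y)"
proof -
  have P: "fl P" "rk P = k" "card P = 2 ^ k - 1" "thick P" "P \<subseteq> E"
    using assms flD by (auto simp: pg_def)
  obtain B where B: "B \<subseteq> P" "I B" "card B = k" using basis_exists[of P] P by blast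
  obtain b where b: "bij_betw b {0..<k} B"
    using ex_bij_betw_nat_finite[OF indep_finite[OF B(2)]] B by blast
  define H where "H i = cl (B - {b i})" for i
  define \<phi> where "\<phi> x = {i. i < k \<and> x \<notin> H i}" for x
  have BE: "B \<subseteq> E" using B P by blast
  have clB: "cl B = P" using cl_basis[of B P] B P flD by simp
  have hyp: "hyp (H i) P" if "i < k" for i
  proof -
    have bi: "b i \<in> B" using b that by (auto simp: bij_betw_def)
    have ID: "I (B - {b i})" by (rule indep_subset[OF B(2)]) auto
    have sE: "B - {b i} \<subseteq> E" using BE by blast
    show ?thesis
      unfolding hyp_def H_def using fl_cl[OF sE] rk_cl[OF sE] rk_indep[OF ID] B P
        cl_subset_fl[of P "B - {b i}"] card_Suc_Diff1[OF indep_finite[OF B(2)] bi] by auto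
  qed
  \<comment> \<open>A point in all coordinate hyperplanes would be spanned by the empty subset of
    \<open>B\<close>.\<close>
  have ne: "\<phi> x \<noteq> {}" if "x \<in> P" for x
  proof
    assume e: "\<phi> x = {}"
    have "x \<in> cl (B - {c})" if "c \<in> B" for c
    proof -
      obtain i where "i < k" "c = b i"
        using bij_betw_imp_surj_on[OF b] \<open>c \<in> B\<close> by fastforce
      then show ?thesis using e by (auto simp: \<phi>_def H_def)
    qed
    then have e: "{c \<in> B. x \<notin> cl (B - {c})} = {}" by blast
    have "x \<in> cl {c \<in> B. x \<notin> cl (B - {c})}"
      using in_cl_fundamental_circuit[of B x] B clB that by simp
    then show False unfolding e using cl_empty by simp
  qed
  have add: "i \<in> \<phi> z \<longleftrightarrow> (i \<in> \<phi> x) \<noteq> (i \<in> \<phi> y)"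
    if xyz: "x \<in> P" "y \<in> P" "x \<noteq> y" "z \<in> cl {x, y}" "z \<noteq> x" "z \<noteq> y" for x y z i
  proof (cases "i < k")
    case True
    have fH: "fl (H i)" using hyp[OF True] by (simp add: hyp_def)
    have E: "x \<in> E" "y \<in> E" using xyz P by auto
    have l: "v \<in> H i" if "v \<in> cl {u, w}" "u \<in> H i" "w \<in> H i" for u v w
      using cl_subset_fl[OF fH, of "{u, w}"] that by auto
    have "x \<in> cl {y, z}" "y \<in> cl {x, z}"
      using line_exchange[of z x y] line_exchange'[of z x y] xyz E by auto
    then have "x \<in> H i \<Longrightarrow> y \<in> H i \<Longrightarrow> z \<in> H i" "y \<in> H i \<Longrightarrow> z \<in> H i \<Longrightarrow> x \<in> H i"
      "x \<in> H i \<Longrightarrow> z \<in> H i \<Longrightarrow> y \<in> H i"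
      using l[of z x y] l[of x y z] l[of y x z] xyz(4) by blast+
    moreover have "x \<notin> H i \<Longrightarrow> y \<notin> H i \<Longrightarrow> z \<in> H i"
      using pg_third_in_hyp[OF assms hyp[OF True] _ _ xyz(3-6)] xyz(1,2) by blast
    ultimately have "z \<in> H i \<longleftrightarrow> (x \<in> H i) = (y \<in> H i)" by blast
    then show ?thesis using True by (auto simp: \<phi>_def)
  qed (simp add: \<phi>_def)
  have inj: "inj_on \<phi> P"
  proof (rule inj_onI, rule ccontr)
    fix x y assume xy: "x \<in> P" "y \<in> P" "\<phi> x = \<phi> y" "x \<noteq> y"
    obtain z where z: "z \<in> cl {x, y}" "z \<noteq> x" "z \<noteq> y" using thickD[OF P(4) xy(1,2,4)] .
    then have "\<phi> z = {}" using add[of x y z] xy by blast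
    moreover have "z \<in> P" using cl_subset_fl[OF P(1), of "{x, y}"] xy z by auto
    ultimately show False using ne by blast
  qed
  have "\<phi> ` P \<subseteq> Pow {0..<k} - {{}}" using ne by (auto simp: \<phi>_def)
  moreover have "card (\<phi> ` P) = card (Pow {0..<k} - {{}})"
    using card_image[OF inj] P by (simp add: card_Pow)
  ultimately have "\<phi> ` P = Pow {0..<k} - {{}}" by (intro card_subset_eq) auto
  then show ?thesis using that[of \<phi>] inj add by (simp add: bij_betw_def)
qed

text \<open>Both directions replace two points of a set by the third point of their line, which does
  not change the sum: starting from an independent set this ends in a single nonzero vector,
  starting from a circuit it produces a smaller dependent set.\<close>

lemma pg_representation:
  assumes "pg P k"
  obtains \<phi> where "bij_betw \<phi> P (Pow {0..<k} - {{}})"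
    "\<And>X. X \<subseteq> P \<Longrightarrow> I X \<longleftrightarrow> gf2_indep (\<phi> ` X)"
proof -
  obtain \<phi> where bij: "bij_betw \<phi> P (Pow {0..<k} - {{}})"
    and add: "\<And>x y z i. x \<in> P \<Longrightarrow> y \<in> P \<Longrightarrow> x \<noteq> y \<Longrightarrow> z \<in> cl {x, y} \<Longrightarrow> z \<noteq> x \<Longrightarrow> z \<noteq> y \<Longrightarrow>
       i \<in> \<phi> z \<longleftrightarrow> (i \<in> \<phi> x) \<noteq> (i \<in> \<phi> y)"
    using pg_coordinates[OF assms] by metis
  have P: "fl P" "rk P = k" "thick P" "P \<subseteq> E" using assms flD by (auto simp: pg_def)
  have finP: "finite P" using P fl_finite by blast
  have inj: "inj_on \<phi> P" using bij by (simp add: bij_betw_def)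
  have ne: "\<phi> x \<noteq> {}" if "x \<in> P" for x using bij that by (auto simp: bij_betw_def)
  have ins: "i \<in> gf2_sum (\<phi> ` insert x R) \<longleftrightarrow> (i \<in> \<phi> x) \<noteq> (i \<in> gf2_sum (\<phi> ` R))"
    if "R \<subseteq> P" "x \<in> P" "x \<notin> R" for i x R
  proof -
    have "\<phi> x \<notin> \<phi> ` R" using inj_on_image_mem_iff[OF inj that(2,1)] that by blast
    then show ?thesis using gf2_sum_insert finite_subset[OF that(1) finP] by simp
  qed
  have third: "\<exists>z\<in>P. z \<in> cl {x, y} \<and> z \<noteq> x \<and> z \<noteq> y" if xy: "x \<in> P" "y \<in> P" "x \<noteq> y" for x y
  proof -
    obtain z where z: "z \<in> cl {x, y}" "z \<noteq> x" "z \<noteq> y" using thickD[OF P(3) xy] .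
    moreover have "z \<in> P" using cl_subset_fl[OF P(1), of "{x, y}"] that z by auto
    ultimately show ?thesis by blast
  qed
  have swap: "gf2_sum (\<phi> ` insert z R) = gf2_sum (\<phi> ` insert x (insert y R))"
    if "x \<in> P" "y \<in> P" "x \<noteq> y" "z \<in> P" "z \<in> cl {x, y}" "z \<noteq> x" "z \<noteq> y" "R \<subseteq> P"
      "x \<notin> R" "y \<notin> R" "z \<notin> R" for x y z R
  proof (rule set_eqI)
    fix i
    have "insert y R \<subseteq> P" "x \<notin> insert y R" using that by auto
    then show "i \<in> gf2_sum (\<phi> ` insert z R) \<longleftrightarrow> i \<in> gf2_sum (\<phi> ` insert x (insert y R))"
      using ins[OF that(8,4,11), of i] ins[OF _ that(1), of "insert y R" i]
        ins[OF that(8,2,10), of i] add[OF that(1-3,5-7), of i] by blast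
  qed
  have indep: "gf2_sum (\<phi> ` T) \<noteq> {}" if "T \<subseteq> P" "I T" "T \<noteq> {}" for T
    using that
  proof (induction "card T" arbitrary: T rule: less_induct)
    case less
    have finT: "finite T" using less indep_finite by blast
    obtain x where x: "x \<in> T" using less by blast
    show ?case
    proof (cases "T = {x}")
      case True
      then show ?thesis using ins[of "{}" x] ne[of x] less x by (auto simp: gf2_sum_def)
    next
      case False
      then obtain y where y: "y \<in> T" "y \<noteq> x" using x by blast
      define R where "R = T - {x, y}"
      have T: "T = insert x (insert y R)" using x y by (auto simp: R_def)
      have xy: "x \<in> P" "y \<in> P" "x \<in> E" "y \<in> E" "R \<subseteq> P" using x y less(2) P by (auto simp: R_def)
      have xyR: "x \<notin> insert y R" "y \<notin> R" "x \<notin> R" "finite R" using y finT by (auto simp: R_def)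
      have cT: "card T = Suc (Suc (card R))" unfolding T using xyR by simp
      obtain z where z: "z \<in> P" "z \<in> cl {x, y}" "z \<noteq> x" "z \<noteq> y" using third xy y by metis
      \<comment> \<open>Otherwise \<open>x\<close>, being on the line through \<open>y\<close> and
        \<open>z\<close>, would be spanned by \<open>insert y R\<close>, against the independence of
        \<open>T\<close>.\<close>
      have zR: "z \<notin> cl R"
      proof
        assume "z \<in> cl R"
        then have "z \<in> cl (insert y R)" using cl_mono[of R "insert y R"] by blast
        then have "cl {y, z} \<subseteq> cl (insert y R)"
          using xy P cl_increasing[of "insert y R"] by (intro cl_subset_cl) auto
        moreover have "x \<in> cl {y, z}" using line_exchange z xy by blast
        moreover have "x \<notin> cl (insert y R)"
          using indep_insertD[OF _ xyR(1)] less(3) unfolding T by blast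
        ultimately show False by blast
      qed
      have IR: "I R" unfolding R_def by (rule indep_subset[OF less(3)]) auto
      have zR': "z \<notin> R" using zR cl_increasing[OF indep_subset_ground[OF IR]] by blast
      have Iz: "I (insert z R)" using indep_insert[OF IR] zR z P by blast
      have "card (insert z R) < card T" using zR' xyR cT by simp
      then have "gf2_sum (\<phi> ` insert z R) \<noteq> {}"
        using xy(5) z(1) by (intro less(1)[OF _ _ Iz]) auto
      moreover have "gf2_sum (\<phi> ` insert z R) = gf2_sum (\<phi> ` T)"
        unfolding T using swap[OF xy(1,2) y(2)[symmetric] z xy(5) xyR(3,2) zR'] .
      ultimately show ?thesis by simp
    qed
  qed
  have dep: "\<exists>S\<subseteq>T. S \<noteq> {} \<and> gf2_sum (\<phi> ` S) = {}" if "T \<subseteq> P" "\<not> I T" for T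
    using that
  proof (induction "card T" arbitrary: T rule: less_induct)
    case less
    have finT: "finite T" using less finP finite_subset by blast
    have TE: "T \<subseteq> E" using less P by blast
    show ?case
    proof (cases "\<exists>x\<in>T. \<not> I (T - {x})")
      case True
      then obtain x where x: "x \<in> T" "\<not> I (T - {x})" by blast
      have "\<exists>S\<subseteq>T - {x}. S \<noteq> {} \<and> gf2_sum (\<phi> ` S) = {}"
        using less(2) x card_Diff1_less[OF finT x(1)] by (intro less(1)) auto
      then show ?thesis by blast
    next
      case False
      obtain x where x: "x \<in> T" using less(3) indep_empty by (metis ex_in_conv)
      have "T \<noteq> {x}" using less(3) indep_pair[of x x] x TE by auto
      then obtain y where y: "y \<in> T" "y \<noteq> x" using x by blast
      define R where "R = T - {x, y}"
      have T: "T = insert x (insert y R)" using x y by (auto simp: R_def)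
      have xy: "x \<in> P" "y \<in> P" "x \<in> E" "y \<in> E" "R \<subseteq> P" "R \<subseteq> E" "x \<notin> R" "y \<notin> R"
        using x y less(2) P by (auto simp: R_def)
      have xyR: "x \<notin> insert y R" "finite R" using y finT by (auto simp: R_def)
      have cT: "card T = Suc (Suc (card R))" unfolding T using xyR xy by simp
      obtain z where z: "z \<in> P" "z \<in> cl {x, y}" "z \<noteq> x" "z \<noteq> y" using third xy y by metis
      have Iy: "I (insert y R)" "I (insert x R)"
      proof -
        have "insert y R = T - {x}" "insert x R = T - {y}" unfolding T using xyR xy by auto
        then show "I (insert y R)" "I (insert x R)" using False x y by auto
      qed
      then have yR: "y \<notin> cl R" "x \<notin> cl R" using indep_insertD xy by blast+
      have IR: "I R" using indep_subset[OF Iy(1)] by blast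
      have yT: "insert y R \<subseteq> T" unfolding T by blast
      have cy: "card (insert y R) = Suc (card R)" using xyR xy by simp
      have "rk T < card T" using indep_if_rk[OF finT] less(3) by (meson not_le)
      moreover have "Suc (card R) \<le> rk T" using card_le_rk[OF yT Iy(1)] cy by simp
      ultimately have "card (insert y R) = rk T" using cT cy by linarith
      then have clT: "cl T = cl (insert y R)" using cl_basis[OF yT Iy(1)] by blast
      \<comment> \<open>Here \<open>T\<close> is a circuit, so \<open>cl R\<close> is a hyperplane
        of \<open>cl T\<close> avoiding \<open>x\<close> and \<open>y\<close>. Extended to a
        hyperplane of \<open>P\<close>, it must contain the third point \<open>z\<close>, so
        \<open>z\<close> is in \<open>cl R\<close> and \<open>insert z R\<close> is dependent unless
        \<open>z\<close> is in \<open>R\<close>.\<close>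
      have h: "hyp (cl R) (cl T)"
        unfolding hyp_def clT using fl_cl[of R] fl_cl[of "insert y R"] xy cl_mono[of R "insert y R"]
          rk_cl[of R] rk_cl[of "insert y R"] rk_indep[OF IR] rk_indep[OF Iy(1)] indep_finite[OF IR]
        by auto
      have "cl T \<subseteq> P" using cl_subset_fl[OF P(1)] less by blast
      then obtain Q where Q: "hyp Q P" "Q \<inter> cl T = cl R" using hyp_extend[OF h P(1)] by blast
      have T': "T \<subseteq> cl T" using cl_increasing TE by blast
      then have "x \<notin> Q" "y \<notin> Q" using Q yR x y by blast+
      then have "z \<in> Q" using pg_third_in_hyp[OF assms Q(1), of x y z] xy y z by auto
      moreover have "z \<in> cl T" using cl_mono[of "{x, y}" T] x y z by blast
      ultimately have zR: "z \<in> cl R" using Q by blast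
      show ?thesis
      \<comment> \<open>If \<open>z\<close> is already in \<open>R\<close>, the three points of the
        line lie in \<open>T\<close> and sum to zero.\<close>
      proof (cases "z \<in> R")
        case True
        have "i \<notin> gf2_sum (\<phi> ` {z, x, y})" for i
        proof -
          have "i \<notin> gf2_sum (\<phi> ` {})" by (simp add: gf2_sum_def)
          moreover have "{x, y} \<subseteq> P" "z \<notin> {x, y}" "{y} \<subseteq> P" "x \<notin> {y}" using xy z y by auto
          ultimately show ?thesis
            using ins[of "{x, y}" z i] ins[of "{y}" x i] ins[of "{}" y i] xy(1,2) z(1)
              add[OF xy(1,2) y(2)[symmetric] z(2-4), of i] by blast
        qed
        then have "gf2_sum (\<phi> ` {z, x, y}) = {}" by blast
        then show ?thesis using True x y by (intro exI[of _ "{z, x, y}"]) (auto simp: R_def)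
      next
        case z': False
        have "\<not> I (insert z R)" using indep_insertD z' zR by blast
        moreover have "card (insert z R) < card T"
          using z' xyR cT by simp
        ultimately obtain S where S: "S \<subseteq> insert z R" "S \<noteq> {}" "gf2_sum (\<phi> ` S) = {}"
          using less(1)[of "insert z R"] xy(5) z(1) by (metis insert_subset)
        \<comment> \<open>The zero sum must use \<open>z\<close>, since \<open>R\<close> is
          independent; replacing \<open>z\<close> by \<open>x\<close> and \<open>y\<close> turns it
          into a zero sum inside \<open>T\<close>.\<close>
        have "z \<in> S"
        proof (rule ccontr)
          assume "z \<notin> S"
          then have "S \<subseteq> R" using S by blast
          then show False using indep[of S] S xy indep_subset[OF IR] by blast
        qed
        then have "gf2_sum (\<phi> ` insert x (insert y (S - {z}))) = {}"
          using swap[of x y z "S - {z}"] xy z S y by (auto simp: insert_absorb)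
        moreover have "insert x (insert y (S - {z})) \<subseteq> T" using S T by blast
        ultimately show ?thesis by blast
      qed
    qed
  qed
  have "I X \<longleftrightarrow> gf2_indep (\<phi> ` X)" if X: "X \<subseteq> P" for X
  proof
    assume IX: "I X"
    show "gf2_indep (\<phi> ` X)"
      unfolding gf2_indep_def
    proof (intro allI impI)
      fix V assume V: "V \<subseteq> \<phi> ` X" "V \<noteq> {}"
      then obtain S where S: "S \<subseteq> X" "V = \<phi> ` S" using subset_imageE by metis
      then show "gf2_sum V \<noteq> {}" using indep[of S] V X indep_subset[OF IX S(1)] by blast
    qed
  next
    assume g: "gf2_indep (\<phi> ` X)"
    show "I X"
    proof (rule ccontr)
      assume "\<not> I X"
      from dep[OF X this] obtain S where S: "S \<subseteq> X" "S \<noteq> {}" "gf2_sum (\<phi> ` S) = {}" by blast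
      moreover have "\<phi> ` S \<subseteq> \<phi> ` X" "\<phi> ` S \<noteq> {}" using S by auto
      ultimately show False using g unfolding gf2_indep_def by blast
    qed
  qed
  with that bij show ?thesis by blast
qed

subsection \<open>Direct sums\<close>

text \<open>The rank inequality expresses that the sum is direct. Bases of the parts extending the
  traces of \<open>X\<close> have a union that spans \<open>F\<close> with at most
  \<open>rk F\<close> elements, so this union is independent.\<close>

lemma indep_if_parts_indep:
  fixes s :: nat
  assumes "(\<Union>j<s. P j) = F" "F \<subseteq> E" "(\<Sum>j<s. rk (P j)) \<le> rk F"
    and "X \<subseteq> F" "\<And>j. j < s \<Longrightarrow> I (X \<inter> P j)"
  shows "I X"
proof -
  have "\<exists>B. X \<inter> P j \<subseteq> B \<and> B \<subseteq> P j \<and> I B \<and> card B = rk (P j)" if "j < s" for j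
    using basis_extend[OF assms(5)[OF that], of "P j"] by (metis inf_le2)
  then obtain B where B: "\<And>j. j < s \<Longrightarrow> X \<inter> P j \<subseteq> B j \<and> B j \<subseteq> P j \<and> I (B j) \<and> card (B j) = rk (P j)"
    by metis
  define U where "U = (\<Union>j<s. B j)"
  have U: "X \<subseteq> U" "U \<subseteq> F"
  proof -
    have "X = (\<Union>j<s. X \<inter> P j)" using assms(1,4) by auto
    also have "\<dots> \<subseteq> U" unfolding U_def using B by (intro UN_mono) auto
    finally show "X \<subseteq> U" .
    show "U \<subseteq> F" unfolding U_def assms(1)[symmetric] using B by (intro UN_mono) auto
  qed
  have finU: "finite U" using finite_subset[OF subset_trans[OF U(2) assms(2)] finite_ground] .
  have "F \<subseteq> cl U"
  proof
    fix e assume "e \<in> F"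
    then obtain j where j: "j < s" "e \<in> P j" using assms(1) by blast
    have "P j \<subseteq> E" using j assms(1,2) by blast
    then have "P j \<subseteq> cl (B j)" using B[OF j(1)] rk_indep by (intro subset_cl_if_rk) auto
    also have "\<dots> \<subseteq> cl U" using j by (intro cl_mono) (auto simp: U_def)
    finally show "e \<in> cl U" using j by blast
  qed
  then have "rk F \<le> rk U" using rk_mono[of F "cl U"] rk_cl[of U] U assms by auto
  moreover have "card U \<le> (\<Sum>j<s. card (B j))" unfolding U_def by (rule card_UN_le) simp
  moreover have "(\<Sum>j<s. card (B j)) = (\<Sum>j<s. rk (P j))" using B by (intro sum.cong) auto
  ultimately have "card U \<le> rk U" using assms(3) by linarith
  then show ?thesis using indep_if_rk[OF finU] indep_subset[OF _ U(1)] by blast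
qed

text \<open>Closure in a direct sum is computed part by part: if \<open>z\<close> were not spanned
  by the trace of \<open>X\<close> on its own part, it could be added to a basis of
  \<open>X\<close>, as \<open>indep_if_parts_indep\<close> tests only the parts.\<close>

lemma cl_part:
  fixes s :: nat
  assumes "(\<Union>j<s. P j) = F" "F \<subseteq> E" "(\<Sum>j<s. rk (P j)) \<le> rk F"
    and disj: "\<And>i j. i < s \<Longrightarrow> j < s \<Longrightarrow> i \<noteq> j \<Longrightarrow> P i \<inter> P j = {}"
    and "X \<subseteq> F" "l < s" "z \<in> P l" "z \<in> cl X"
  shows "z \<in> cl (X \<inter> P l)"
proof (rule ccontr)
  assume n: "z \<notin> cl (X \<inter> P l)"
  obtain J where J: "J \<subseteq> X" "I J" "card J = rk X" using basis_exists by blast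
  have zE: "z \<in> E" "z \<in> F" using assms by auto
  have nJ: "z \<notin> cl (J \<inter> P l)" using n cl_mono[of "J \<inter> P l" "X \<inter> P l"] J(1) by blast
  have "I (insert z J)"
  proof (rule indep_if_parts_indep[OF assms(1-3)])
    show "insert z J \<subseteq> F" using J zE assms by blast
    fix j assume j: "j < s"
    have IJ: "I (J \<inter> P j)" by (rule indep_subset[OF J(2)]) auto
    show "I (insert z J \<inter> P j)"
    proof (cases "j = l")
      case True
      then have "insert z J \<inter> P j = insert z (J \<inter> P l)" using assms by auto
      then show ?thesis using indep_insert[OF _ zE(1) nJ] IJ True by simp
    next
      case False
      then have "insert z J \<inter> P j = J \<inter> P j" using disj[OF j assms(6)] assms(7) by auto
      then show ?thesis using IJ by simp
    qed
  qed
  moreover have "z \<notin> J"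
    using nJ assms(7) cl_increasing[of "J \<inter> P l"] J(2) indep_subset_ground by blast
  ultimately have "z \<notin> cl J" using indep_insertD by blast
  then show False using assms cl_basis[OF J] by simp
qed

text \<open>The prescribed ranks of the parts add up to \<open>rk F\<close>, so the sum is direct by
  \<open>indep_if_parts_indep\<close>. Larger parts come first, as in \<open>Mrt_E\<close>.\<close>

definition decomp :: "nat \<Rightarrow> 'a set \<Rightarrow> (nat \<Rightarrow> 'a set) \<Rightarrow> bool" where
  "decomp t F P \<longleftrightarrow> t \<ge> 1 \<and> fl F \<and> (\<Union>j<t. P j) = F \<and>
     (\<forall>i<t. \<forall>j<t. i \<noteq> j \<longrightarrow> P i \<inter> P j = {}) \<and>
     (\<forall>j<t. pg (P j) (Mrt_comp_rank (rk F) t j))"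

lemma decompD:
  assumes "decomp t F P"
  shows "t \<ge> 1" "fl F" "(\<Union>j<t. P j) = F" "F \<subseteq> E" "(\<Sum>j<t. rk (P j)) \<le> rk F"
    "\<And>i j. i < t \<Longrightarrow> j < t \<Longrightarrow> i \<noteq> j \<Longrightarrow> P i \<inter> P j = {}"
    "\<And>j. j < t \<Longrightarrow> pg (P j) (Mrt_comp_rank (rk F) t j)"
    "\<And>j. j < t \<Longrightarrow> rk (P j) = Mrt_comp_rank (rk F) t j"
    "\<And>j. j < t \<Longrightarrow> fl (P j)" "\<And>j. j < t \<Longrightarrow> thick (P j)" "\<And>j. j < t \<Longrightarrow> P j \<subseteq> F"
proof -
  show 1: "t \<ge> 1" "fl F" "(\<Union>j<t. P j) = F"
    "\<And>i j. i < t \<Longrightarrow> j < t \<Longrightarrow> i \<noteq> j \<Longrightarrow> P i \<inter> P j = {}"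
    and 2: "\<And>j. j < t \<Longrightarrow> pg (P j) (Mrt_comp_rank (rk F) t j)"
    using assms by (auto simp: decomp_def)
  show "F \<subseteq> E" using 1 flD by blast
  show 3: "\<And>j. j < t \<Longrightarrow> rk (P j) = Mrt_comp_rank (rk F) t j"
    and "\<And>j. j < t \<Longrightarrow> fl (P j)" "\<And>j. j < t \<Longrightarrow> thick (P j)"
    using 2 by (auto simp: pg_def)
  show "\<And>j. j < t \<Longrightarrow> P j \<subseteq> F" using 1 by blast
  have "(\<Sum>j<t. rk (P j)) = (\<Sum>j<t. Mrt_comp_rank (rk F) t j)" using 3 by (intro sum.cong) auto
  then show "(\<Sum>j<t. rk (P j)) \<le> rk F" using sum_Mrt_comp_rank 1 by simp
qed

text \<open>The parts can be read off from the lines, so decompositions of different flats can be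
  compared. If \<open>u\<close> and \<open>v\<close> were in different parts, any third point
  \<open>w\<close> would give a set with at most two elements in each part, hence an independent
  one.\<close>

lemma decomp_part_iff:
  assumes D: "decomp t F P" and "i < t" "u \<in> P i" "v \<in> F" "u \<noteq> v"
  shows "v \<in> P i \<longleftrightarrow> (\<exists>w\<in>cl {u, v}. w \<noteq> u \<and> w \<noteq> v)"
proof
  assume "v \<in> P i"
  then show "\<exists>w\<in>cl {u, v}. w \<noteq> u \<and> w \<noteq> v"
    using thickD[OF decompD(10)[OF D assms(2)] assms(3)] assms(5) by metis
next
  assume "\<exists>w\<in>cl {u, v}. w \<noteq> u \<and> w \<noteq> v"
  then obtain w where w: "w \<in> cl {u, v}" "w \<noteq> u" "w \<noteq> v" by blast
  show "v \<in> P i"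
  proof (rule ccontr)
    assume v: "v \<notin> P i"
    have uF: "u \<in> F" using decompD(11)[OF D] assms by blast
    have wF: "w \<in> F" using cl_subset_fl[OF decompD(2)[OF D], of "{u, v}"] w uF assms by auto
    have FE: "F \<subseteq> E" using decompD(4)[OF D] .
    have "I {w, u, v}"
    proof (rule indep_if_parts_indep[OF decompD(3-5)[OF D]])
      show "{w, u, v} \<subseteq> F" using uF wF assms by blast
      fix j assume j: "j < t"
      show "I ({w, u, v} \<inter> P j)"
      proof (rule indep_if_card_le_2)
        have "{w, u, v} \<inter> P j \<subseteq> {w, u} \<or> {w, u, v} \<inter> P j \<subseteq> {w, v}"
          using v decompD(6)[OF D j assms(2)] assms(3) by blast
        moreover have "card {w, u} \<le> 2" "card {w, v} \<le> 2" by (simp_all add: card_insert_if)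
        ultimately show "card ({w, u, v} \<inter> P j) \<le> 2"
          by (meson card_mono finite.emptyI finite.insertI order_trans)
        show "{w, u, v} \<inter> P j \<subseteq> E" using uF wF assms(4) FE by blast
      qed
    qed
    then show False using indep_insertD[of w "{u, v}"] w by blast
  qed
qed

text \<open>A point \<open>e\<close> outside \<open>H'\<close> spans \<open>H\<close> together with
  \<open>H'\<close>. By \<open>cl_part\<close> every part without \<open>e\<close> is spanned by its
  trace on \<open>H'\<close>, and the part of \<open>e\<close> is spanned by \<open>e\<close> and
  its trace.\<close>

lemma decomp_hyp:
  assumes D: "decomp t H P" and h: "hyp H' H"
  obtains i where "i < t" "\<And>j. j < t \<Longrightarrow> j \<noteq> i \<Longrightarrow> P j \<subseteq> H'" "hyp (P i \<inter> H') (P i)"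
proof -
  have H': "fl H'" "H' \<subseteq> H" using h by (auto simp: hyp_def)
  obtain e where e: "e \<in> H" "e \<notin> H'" using hyp_nonempty_diff[OF h] by blast
  then obtain i where i: "i < t" "e \<in> P i" using decompD(3)[OF D] by blast
  have c: "p \<in> cl (insert e H' \<inter> P j)" if "j < t" "p \<in> P j" for j p
  proof (rule cl_part[OF decompD(3-5)[OF D] decompD(6)[OF D]])
    show "p \<in> cl (insert e H')"
      using hyp_cl_insert[OF h e] decompD(11)[OF D that(1)] that by blast
  qed (use that e H' in auto)
  have "P j \<subseteq> H'" if "j < t" "j \<noteq> i" for j
  proof
    fix p assume "p \<in> P j"
    then have "p \<in> cl (insert e H' \<inter> P j)" using c that by blast
    moreover have "insert e H' \<inter> P j \<subseteq> H'" using decompD(6)[OF D that(1) i(1) that(2)] i by blast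
    ultimately show "p \<in> H'" using cl_subset_fl[OF H'(1)] by blast
  qed
  moreover have "hyp (P i \<inter> H') (P i)"
  proof -
    have f: "fl (P i)" using decompD(9)[OF D i(1)] .
    have "insert e H' \<inter> P i = insert e (P i \<inter> H')" using i by blast
    then have "P i \<subseteq> cl (insert e (P i \<inter> H'))" using c[OF i(1)] by auto
    moreover have "cl (insert e (P i \<inter> H')) \<subseteq> P i" using i by (intro cl_subset_fl[OF f]) auto
    moreover have "hyp (P i \<inter> H') (cl (insert e (P i \<inter> H')))"
      using fl_Int[OF f H'(1)] e flD(1)[OF f] i by (intro cl_insert_hyp) auto
    ultimately show ?thesis by (simp add: subset_antisym)
  qed
  ultimately show ?thesis using that i by blast
qed

text \<open>The coordinate maps of the parts are glued, each point being tagged with the index of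
  its part; on both sides independence is tested on the parts.\<close>

lemma decomp_iso:
  assumes D: "decomp t E P"
  shows "matroid_iso E I (Mrt_E (rk E) t) (Mrt_I (rk E) t)"
proof -
  let ?r = "rk E"
  let ?k = "Mrt_comp_rank ?r t"
  have "\<exists>\<phi>. bij_betw \<phi> (P j) (Pow {0..<?k j} - {{}}) \<and> (\<forall>X. X \<subseteq> P j \<longrightarrow> (I X \<longleftrightarrow> gf2_indep (\<phi> ` X)))"
    if "j < t" for j
    using pg_representation[OF decompD(7)[OF D that]] by metis
  then obtain \<phi> where \<phi>: "\<And>j. j < t \<Longrightarrow> bij_betw (\<phi> j) (P j) (Pow {0..<?k j} - {{}})"
    "\<And>j X. j < t \<Longrightarrow> X \<subseteq> P j \<Longrightarrow> I X \<longleftrightarrow> gf2_indep (\<phi> j ` X)"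
    by metis
  define idx where "idx x = (THE j. j < t \<and> x \<in> P j)" for x
  have idx: "idx x = j" if "j < t" "x \<in> P j" for x j
    unfolding idx_def using that decompD(6)[OF D] by (intro the_equality) blast+
  have ex: "\<exists>j<t. x \<in> P j" if "x \<in> E" for x using decompD(3)[OF D] that by blast
  define \<Phi> where "\<Phi> x = (idx x, \<phi> (idx x) x)" for x
  have \<Phi>: "\<Phi> x = (j, \<phi> j x)" if "j < t" "x \<in> P j" for x j using idx[OF that] by (simp add: \<Phi>_def)
  have im: "{v. (j, v) \<in> \<Phi> ` X} = \<phi> j ` (X \<inter> P j)" if jX: "j < t" "X \<subseteq> E" for j X
  proof (rule set_eqI)
    fix v
    show "v \<in> {v. (j, v) \<in> \<Phi> ` X} \<longleftrightarrow> v \<in> \<phi> j ` (X \<inter> P j)"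
    proof
      assume "v \<in> {v. (j, v) \<in> \<Phi> ` X}"
      then obtain x where x: "x \<in> X" "(j, v) = \<Phi> x" by blast
      obtain l where l: "l < t" "x \<in> P l" using ex x jX by blast
      then have "l = j" "v = \<phi> j x" using \<Phi>[OF l] x by auto
      then show "v \<in> \<phi> j ` (X \<inter> P j)" using x l by blast
    next
      assume "v \<in> \<phi> j ` (X \<inter> P j)"
      then obtain x where x: "x \<in> X" "x \<in> P j" "v = \<phi> j x" by blast
      then have "(j, v) = \<Phi> x" using \<Phi> that by simp
      then show "v \<in> {v. (j, v) \<in> \<Phi> ` X}" using x by blast
    qed
  qed
  have sub: "\<Phi> ` E \<subseteq> Mrt_E ?r t"
  proof
    fix p assume "p \<in> \<Phi> ` E"
    then obtain x where x: "x \<in> E" "p = \<Phi> x" by blast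
    obtain l where l: "l < t" "x \<in> P l" using ex x by blast
    have "\<phi> l x \<in> Pow {0..<?k l} - {{}}" using bij_betwE[OF \<phi>(1)[OF l(1)]] l by blast
    then show "p \<in> Mrt_E ?r t" using x \<Phi>[OF l] l by (simp add: Mrt_E_def)
  qed
  have "Mrt_E ?r t \<subseteq> \<Phi> ` E"
  proof
    fix p assume p: "p \<in> Mrt_E ?r t"
    obtain j v where jv: "p = (j, v)" "j < t" "v \<in> Pow {0..<?k j} - {{}}"
      using p by (auto simp: Mrt_E_def)
    then have "v \<in> \<phi> j ` P j" using bij_betw_imp_surj_on[OF \<phi>(1)[OF jv(2)]] by simp
    then obtain x where x: "x \<in> P j" "v = \<phi> j x" by blast
    then have "\<Phi> x = p" "x \<in> E" using \<Phi> jv decompD(11)[OF D jv(2)] by auto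
    then show "p \<in> \<Phi> ` E" by blast
  qed
  moreover have "inj_on \<Phi> E"
  proof (rule inj_onI)
    fix x y assume xy: "x \<in> E" "y \<in> E" "\<Phi> x = \<Phi> y"
    obtain l m where lm: "l < t" "x \<in> P l" "m < t" "y \<in> P m" using ex xy by blast
    then have e: "l = m" "\<phi> l x = \<phi> m y" using \<Phi>[OF lm(1,2)] \<Phi>[OF lm(3,4)] xy by auto
    then show "x = y" using inj_onD[OF bij_betw_imp_inj_on[OF \<phi>(1)[OF lm(1)]]] lm by metis
  qed
  ultimately have "bij_betw \<Phi> E (Mrt_E ?r t)" using sub by (auto simp: bij_betw_def)
  moreover have "I X \<longleftrightarrow> Mrt_I ?r t (\<Phi> ` X)" if X: "X \<subseteq> E" for X
  proof -
    have "I X \<longleftrightarrow> (\<forall>j<t. I (X \<inter> P j))"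
      using indep_if_parts_indep[OF decompD(3-5)[OF D] X] indep_subset[OF _ Int_lower1] by metis
    also have "\<dots> \<longleftrightarrow> (\<forall>j<t. gf2_indep (\<phi> j ` (X \<inter> P j)))" using \<phi>(2) by auto
    also have "\<dots> \<longleftrightarrow> Mrt_I ?r t (\<Phi> ` X)"
    proof -
      have "\<Phi> ` X \<subseteq> Mrt_E ?r t" using sub X by blast
      then show ?thesis using im[OF _ X] by (simp add: Mrt_I_def)
    qed
    finally show ?thesis .
  qed
  ultimately show ?thesis unfolding matroid_iso_def by blast
qed

subsection \<open>Matroids with cocircuits of size at most two\<close>

text \<open>The family consists of the fundamental circuits of the elements outside a basis
  \<open>B\<close>. If those of \<open>e\<close> and \<open>e'\<close> shared a basis element
  \<open>b\<close>, the cocircuit avoiding the span of \<open>B - {b}\<close> would contain all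
  three. A set \<open>X\<close> containing none of them is independent by a simultaneous exchange
  along the disjoint circuits.\<close>

lemma circuit_family:
  assumes "fl F" and small: "\<And>H. hyp H F \<Longrightarrow> card (F - H) \<le> 2"
  obtains \<C> where "\<C> \<subseteq> Pow F" "finite \<C>" "card F = rk F + card \<C>"
    "\<And>C. C \<in> \<C> \<Longrightarrow> circuit E I C"
    "\<And>C D. C \<in> \<C> \<Longrightarrow> D \<in> \<C> \<Longrightarrow> C \<noteq> D \<Longrightarrow> C \<inter> D = {}"
    "\<And>X. X \<subseteq> F \<Longrightarrow> I X \<longleftrightarrow> (\<forall>C\<in>\<C>. \<not> C \<subseteq> X)"
proof -
  have FE: "F \<subseteq> E" "finite F" using flD(1)[OF assms(1)] fl_finite[OF assms(1)] by auto
  obtain B where B: "B \<subseteq> F" "I B" "card B = rk F" using basis_exists by blast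
  have BE: "B \<subseteq> E" "finite B" using B FE finite_subset by auto
  have clB: "cl B = F" using cl_basis[OF B] flD(2)[OF assms(1)] by simp
  define D where "D e = {b \<in> B. e \<notin> cl (B - {b})}" for e
  define C where "C e = insert e (D e)" for e
  have DB: "D e \<subseteq> B" for e by (auto simp: D_def)
  have ID: "I (D e)" for e using indep_subset[OF B(2) DB] .
  have eD: "e \<in> cl (D e)" if "e \<in> F" for e
    using in_cl_fundamental_circuit[OF B(2)] that clB by (simp add: D_def)
  have CF: "C e \<subseteq> F" if "e \<in> F - B" for e using that DB[of e] B(1) by (auto simp: C_def)
  have circ: "circuit E I (C e)" if e: "e \<in> F - B" for e
  proof -
    have eE: "e \<in> E" "e \<notin> D e" "e \<in> F" using e FE DB[of e] by auto
    have "\<not> I (C e)" using indep_insertD[OF _ eE(2)] eD[OF eE(3)] by (auto simp: C_def)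
    moreover have "I (C e - {x})" if x: "x \<in> C e" for x
    proof (cases "x = e")
      case True
      then have "C e - {x} = D e" using eE by (auto simp: C_def)
      then show ?thesis using ID by simp
    next
      case False
      then have xD: "x \<in> D e" using x by (simp add: C_def)
      have "e \<notin> cl (B - {x})" using xD by (simp add: D_def)
      moreover have "cl (D e - {x}) \<subseteq> cl (B - {x})" using DB[of e] by (intro cl_mono) auto
      ultimately have "e \<notin> cl (D e - {x})" by blast
      moreover have "I (D e - {x})" by (rule indep_subset[OF ID[of e]]) auto
      ultimately have "I (insert e (D e - {x}))" using indep_insert eE(1) by simp
      moreover have "C e - {x} = insert e (D e - {x})" using False by (auto simp: C_def)
      ultimately show ?thesis by simp
    qed
    moreover have "C e \<subseteq> E" using CF[OF e] FE by blast
    ultimately show ?thesis unfolding circuit_def by blast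
  qed
  have disj: "C e \<inter> C e' = {}" if e: "e \<in> F - B" "e' \<in> F - B" "e \<noteq> e'" for e e'
  proof (rule ccontr)
    assume "C e \<inter> C e' \<noteq> {}"
    then obtain b where "b \<in> C e" "b \<in> C e'" by blast
    then have b: "b \<in> D e" "b \<in> D e'" using e DB[of e] DB[of e'] by (auto simp: C_def)
    have bB: "b \<in> B" using b DB by blast
    have IB: "I (B - {b})" by (rule indep_subset[OF B(2)]) auto
    have sE: "B - {b} \<subseteq> E" using BE by blast
    have bc: "b \<notin> cl (B - {b})"
      using indep_insertD[of b "B - {b}"] B(2) bB by (simp add: insert_absorb)
    have "hyp (cl (B - {b})) F"
      unfolding hyp_def using fl_cl[OF sE] rk_cl[OF sE] rk_indep[OF IB] B assms(1)
        cl_subset_fl[OF assms(1), of "B - {b}"] card_Suc_Diff1[OF BE(2) bB] by auto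
    then have "card (F - cl (B - {b})) \<le> 2" using small by blast
    moreover have "{b, e, e'} \<subseteq> F - cl (B - {b})" using b bB bc B(1) e by (auto simp: D_def)
    then have "card {b, e, e'} \<le> card (F - cl (B - {b}))" using FE by (intro card_mono) auto
    moreover have "b \<noteq> e" "b \<noteq> e'" using e bB by auto
    then have "card {b, e, e'} = 3" using e(3) by simp
    ultimately show False by linarith
  qed
  have indep: "I X" if X: "X \<subseteq> F" and n: "\<And>e. e \<in> F - B \<Longrightarrow> \<not> C e \<subseteq> X" for X
  proof -
    have "\<exists>b. b \<in> D e \<and> b \<notin> X" if "e \<in> X - B" for e
      using n[of e] X that by (auto simp: C_def)
    then obtain g where g: "\<And>e. e \<in> X - B \<Longrightarrow> g e \<in> D e \<and> g e \<notin> X" by metis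
    \<comment> \<open>Each element \<open>e\<close> of \<open>X\<close> outside \<open>B\<close>
      replaces an element \<open>g e\<close> of its circuit that \<open>X\<close> misses; the result
      contains \<open>X\<close> and is shown to be a basis.\<close>
    define B' where "B' = (B - g ` (X - B)) \<union> (X - B)"
    have finX: "finite (X - B)" using X FE finite_subset by blast
    have inj: "inj_on g (X - B)"
    proof (rule inj_onI, rule ccontr)
      fix e e' assume e: "e \<in> X - B" "e' \<in> X - B" "g e = g e'" "e \<noteq> e'"
      then have "g e \<in> C e \<inter> C e'" using g[OF e(1)] g[OF e(2)] by (simp add: C_def)
      moreover have "C e \<inter> C e' = {}" using disj[of e e'] e X by blast
      ultimately show False by blast
    qed
    have gB: "g ` (X - B) \<subseteq> B" using g DB by blast
    have "card B' \<le> card (B - g ` (X - B)) + card (X - B)" unfolding B'_def by (rule card_Un_le)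
    also have "card (B - g ` (X - B)) = card B - card (X - B)"
      using card_Diff_subset[OF finite_imageI[OF finX] gB] card_image[OF inj] by simp
    also have "card B - card (X - B) + card (X - B) = card B"
      using card_mono[OF BE(2) gB] card_image[OF inj] by simp
    finally have cB': "card B' \<le> rk F" using B by simp
    have B'F: "B' \<subseteq> F" using B X by (auto simp: B'_def)
    have B'E: "B' \<subseteq> E" "finite B'" using B'F FE finite_subset by auto
    have "B \<subseteq> cl B'"
    proof
      fix b assume b: "b \<in> B"
      show "b \<in> cl B'"
      proof (cases "b \<in> g ` (X - B)")
        case False
        then have "b \<in> B'" using b by (simp add: B'_def)
        then show ?thesis using cl_increasing[OF B'E(1)] by blast
      next
        case True
        then obtain e where e: "e \<in> X - B" "b = g e" by blast
        have eF: "e \<in> F - B" using e X by blast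
        have bD: "b \<in> D e" using g e by blast
        \<comment> \<open>By disjointness no other exchange touches the circuit of \<open>e\<close>,
          so the removed \<open>b\<close> is recovered from the rest of that circuit.\<close>
        have sub: "insert e (D e - {b}) \<subseteq> B'"
        proof -
          have "x \<notin> g ` (X - B)" if x: "x \<in> D e - {b}" for x
          proof
            assume "x \<in> g ` (X - B)"
            then obtain e' where e': "e' \<in> X - B" "x = g e'" by blast
            then have "e' \<noteq> e" using x e by blast
            then have "C e' \<inter> C e = {}" using disj[of e' e] e' X eF by blast
            moreover have "x \<in> C e'" "x \<in> C e" using g[OF e'(1)] e' x by (auto simp: C_def)
            ultimately show False by blast
          qed
          then show ?thesis using DB[of e] e by (auto simp: B'_def)
        qed
        have "e \<in> cl (insert b (D e - {b}))" using eD[of e] eF bD by (simp add: insert_absorb)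
        moreover have "e \<notin> cl (D e - {b})"
        proof -
          have "e \<notin> cl (B - {b})" using bD by (simp add: D_def)
          moreover have "cl (D e - {b}) \<subseteq> cl (B - {b})" using DB[of e] by (intro cl_mono) auto
          ultimately show ?thesis by blast
        qed
        ultimately have "b \<in> cl (insert e (D e - {b}))" using cl_exchange b BE by blast
        then show ?thesis using cl_mono[OF sub] by blast
      qed
    qed
    then have "rk B \<le> rk B'" using rk_mono[of B "cl B'"] rk_cl[OF B'E(1)] by simp
    then have "card B' \<le> rk B'" using cB' rk_indep[OF B(2)] B(3) by simp
    then have "I B'" using indep_if_rk[OF B'E(2)] by blast
    moreover have "X \<subseteq> B'" using g by (auto simp: B'_def)
    ultimately show ?thesis using indep_subset by blast
  qed
  have ne: "C e \<noteq> {}" for e by (simp add: C_def)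
  have "inj_on C (F - B)"
  proof (rule inj_onI, rule ccontr)
    fix e e' assume e: "e \<in> F - B" "e' \<in> F - B" "C e = C e'" "e \<noteq> e'"
    then show False using disj[OF e(1,2,4)] ne[of e] by simp
  qed
  then have "card (C ` (F - B)) = card F - card B"
    using card_image card_Diff_subset[OF BE(2) B(1)] by fastforce
  then have 1: "card F = rk F + card (C ` (F - B))" using B card_mono[OF FE(2) B(1)] by simp
  have 2: "C ` (F - B) \<subseteq> Pow F" using CF by blast
  have 3: "finite (C ` (F - B))" using FE by simp
  have 4: "circuit E I K" if "K \<in> C ` (F - B)" for K using that circ by blast
  have 5: "K \<inter> L = {}" if "K \<in> C ` (F - B)" "L \<in> C ` (F - B)" "K \<noteq> L" for K L
    using that disj by blast
  have 6: "I X \<longleftrightarrow> (\<forall>K\<in>C ` (F - B). \<not> K \<subseteq> X)" if X: "X \<subseteq> F" for X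
  proof
    assume IX: "I X"
    show "\<forall>K\<in>C ` (F - B). \<not> K \<subseteq> X"
    proof (intro ballI notI)
      fix K assume K: "K \<in> C ` (F - B)" "K \<subseteq> X"
      then have "I K" using indep_subset[OF IX] by blast
      then show False using 4[OF K(1)] by (simp add: circuit_def)
    qed
  next
    assume "\<forall>K\<in>C ` (F - B). \<not> K \<subseteq> X"
    then show "I X" using indep[OF X] by simp
  qed
  show ?thesis by (rule that[OF 2 3 1 4 5 6])
qed

lemma pg_singleton: "x \<in> E \<Longrightarrow> pg {x} 1"
  using rk_indep[OF indep_pair[of x x]] by (simp add: pg_def thick_def flat_def cl_singleton)

lemma pg_empty: "pg {} 0"
  by (simp add: pg_def thick_def flat_def cl_empty rk_empty)

text \<open>The triangles become the parts of rank 2, the uncovered points the parts of rank 1, and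
  any remaining parts are empty.\<close>

lemma triangles_decomp:
  assumes "t \<ge> 1" "fl F" "rk F \<le> 2 * t" "card F = rk F + (rk F - t)"
    and \<C>: "\<C> \<subseteq> Pow F" "finite \<C>" "card \<C> = rk F - t"
    "\<And>C. C \<in> \<C> \<Longrightarrow> circuit E I C"
    "\<And>C D. C \<in> \<C> \<Longrightarrow> D \<in> \<C> \<Longrightarrow> C \<noteq> D \<Longrightarrow> C \<inter> D = {}"
    "\<And>X. X \<subseteq> F \<Longrightarrow> I X \<longleftrightarrow> (\<forall>C\<in>\<C>. \<not> C \<subseteq> X)"
    and tri: "\<And>C. C \<in> \<C> \<Longrightarrow> card C = 3"
  shows "\<exists>P. decomp t F P"
proof -
  let ?r = "rk F"
  let ?m = "?r - t"
  have FE: "F \<subseteq> E" "finite F" using flD(1)[OF assms(2)] fl_finite[OF assms(2)] by auto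
  have pgC: "pg C 2" if C: "C \<in> \<C>" for C
  proof -
    have "C \<subseteq> F" using \<C>(1) C by blast
    then have CF: "C \<subseteq> F" "C \<subseteq> E" "finite C" "card C = 3"
      using FE finite_subset[OF _ FE(2), of C] tri[OF C] by auto
    have c: "\<not> I C" "\<And>x. x \<in> C \<Longrightarrow> I (C - {x})" using \<C>(4)[OF C] by (auto simp: circuit_def)
    have span: "cl (C - {x}) = cl C" "rk C = 2" if x: "x \<in> C" for x
    proof -
      have "card (C - {x}) = 2" using x CF by simp
      moreover have "rk C < 3" using indep_if_rk[OF CF(3)] c(1) CF(4) by (metis not_le)
      moreover have "card (C - {x}) \<le> rk C" using c(2)[OF x] by (intro card_le_rk) auto
      ultimately show "rk C = 2" by linarith
      then show "cl (C - {x}) = cl C"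
        using cl_basis[of "C - {x}" C] c(2)[OF x] \<open>card (C - {x}) = 2\<close> by auto
    qed
    have "C \<noteq> {}" using CF by auto
    then obtain z where z: "z \<in> C" by blast
    \<comment> \<open>A further point \<open>u\<close> on the line cannot exist: replacing
      \<open>z\<close> by \<open>u\<close> leaves no room for a member of the family, since any
      member other than \<open>C\<close> would have to be inside \<open>{u}\<close>.\<close>
    have "cl C \<subseteq> C"
    proof (rule subsetI, rule ccontr)
      fix u assume u: "u \<in> cl C" "u \<notin> C"
      have uF: "u \<in> F" using cl_subset_fl[OF assms(2) CF(1)] u by blast
      have "I (insert u (C - {z}))"
      proof (rule iffD2[OF \<C>(6)], safe)
        fix D assume D: "D \<in> \<C>" "D \<subseteq> insert u (C - {z})"
        show False
        proof (cases "D = C")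
          case True
          then show ?thesis using D z u by blast
        next
          case False
          then have "D \<subseteq> {u}" using \<C>(5)[OF D(1) C] D by blast
          then have "card D \<le> 1" using card_mono[of "{u}" D] by simp
          then show ?thesis using tri[OF D(1)] by simp
        qed
      qed (use uF CF in auto)
      then have "u \<notin> cl (C - {z})" using indep_insertD u by blast
      then show False using span[OF z] u by simp
    qed
    then have flC: "fl C" using cl_increasing[OF CF(2)] CF(2) by (auto simp: flat_def)
    have "thick C"
      unfolding thick_def
    proof (intro ballI impI)
      fix x y assume xy: "x \<in> C" "y \<in> C" "x \<noteq> y"
      have "card (C - {x, y}) = 1" using xy CF by (simp add: card_Diff_subset)
      then obtain w where w: "C - {x, y} = {w}" using card_1_singletonE by blast
      then have "C - {w} = {x, y}" "w \<in> C" "w \<noteq> x" "w \<noteq> y" using xy by auto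
      then show "\<exists>z\<in>cl {x, y}. z \<noteq> x \<and> z \<noteq> y"
        using span(1)[of w] cl_increasing[OF CF(2)] by auto
    qed
    then show ?thesis using flC span(2)[OF z] CF by (simp add: pg_def)
  qed
  define W where "W = F - \<Union>\<C>"
  have "card (\<Union>\<C>) = (\<Sum>C\<in>\<C>. card C)"
  proof (rule card_Union_disjoint)
    show "pairwise disjnt \<C>" using \<C>(5) by (auto simp: pairwise_def disjnt_def)
    show "finite C" if "C \<in> \<C>" for C using that \<C>(1) finite_subset[OF _ FE(2)] by blast
  qed
  also have "\<dots> = 3 * ?m" using tri \<C>(3) by simp
  finally have "card (\<Union>\<C>) = 3 * ?m" .
  moreover have "\<Union>\<C> \<subseteq> F" using \<C>(1) by blast
  ultimately have cW: "card W = ?r - 2 * ?m"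
    unfolding W_def using assms(4) card_Diff_subset[of "\<Union>\<C>" F] finite_subset[OF _ FE(2)] by simp
  have W: "W \<subseteq> F" "finite W" using FE by (auto simp: W_def)
  obtain c where c: "bij_betw c {0..<?m} \<C>" using ex_bij_betw_nat_finite[OF \<C>(2)] \<C>(3) by auto
  obtain w where w: "bij_betw w {0..<?r - 2 * ?m} W" using ex_bij_betw_nat_finite[OF W(2)] cW by auto
  \<comment> \<open>Of the \<open>?r + ?m\<close> points, \<open>3 * ?m\<close> lie in triangles and
    \<open>?r - 2 * ?m\<close> remain, so triangles and single points together fill the indices
    below \<open>?r - ?m\<close>.\<close>
  define P where "P j = (if j < ?m then c j else if j < ?r - ?m then {w (j - ?m)} else {})" for j
  have cC: "c j \<in> \<C>" if "j < ?m" for j using bij_betwE[OF c] that by simp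
  have wW: "w (j - ?m) \<in> W" if "\<not> j < ?m" "j < ?r - ?m" for j
    using bij_betwE[OF w] that by simp
  have PF: "P j \<subseteq> F" for j
    using cC[of j] wW[of j] W \<C>(1) by (auto simp: P_def)
  have "pg (P j) (Mrt_comp_rank ?r t j)" if j: "j < t" for j
  proof -
    \<comment> \<open>The bound \<open>?r - ?m\<close> equals \<open>t\<close> if
      \<open>t \<le> ?r\<close> and \<open>?r\<close> otherwise, so for \<open>j < t\<close> it may
      replace \<open>?r\<close> in \<open>Mrt_comp_rank_small\<close>.\<close>
    have k: "Mrt_comp_rank ?r t j = (if j < ?m then 2 else if j < ?r - ?m then 1 else 0)"
      using Mrt_comp_rank_small[OF j assms(3)] j by auto
    show ?thesis
      unfolding k P_def using pgC[OF cC] pg_singleton pg_empty wW[of j] W(1) FE(1)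
      by (auto simp: subset_iff)
  qed
  moreover have "P i \<inter> P j = {}" if ij: "i \<noteq> j" for i j
  proof -
    have cc: "c i \<inter> c j = {}" if "i < ?m" "j < ?m"
      using \<C>(5)[OF cC[OF that(1)] cC[OF that(2)]] inj_onD[OF bij_betw_imp_inj_on[OF c], of i j] ij that
      by auto
    have cw: "c i \<inter> {w (j - ?m)} = {}" if "i < ?m" "\<not> j < ?m" "j < ?r - ?m" for i j
      using cC[OF that(1)] wW[OF that(2,3)] by (auto simp: W_def)
    have ww: "w (i - ?m) \<noteq> w (j - ?m)" if "\<not> i < ?m" "i < ?r - ?m" "\<not> j < ?m" "j < ?r - ?m"
    proof
      assume "w (i - ?m) = w (j - ?m)"
      moreover have "i - ?m < ?r - 2 * ?m" "j - ?m < ?r - 2 * ?m" using that by linarith+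
      then have "i - ?m \<in> {0..<?r - 2 * ?m}" "j - ?m \<in> {0..<?r - 2 * ?m}" by auto
      ultimately have "i - ?m = j - ?m" using inj_onD[OF bij_betw_imp_inj_on[OF w]] by blast
      then show False using ij that by linarith
    qed
    show ?thesis
      unfolding P_def using cc cw[of i j] cw[of j i] ww by (auto split: if_splits)
  qed
  moreover have "(\<Union>j<t. P j) = F"
  proof
    show "(\<Union>j<t. P j) \<subseteq> F" using PF by blast
    show "F \<subseteq> (\<Union>j<t. P j)"
    proof
      fix x assume x: "x \<in> F"
      show "x \<in> (\<Union>j<t. P j)"
      proof (cases "x \<in> W")
        case True
        then obtain j where j: "j < ?r - 2 * ?m" "x = w j"
          using bij_betw_imp_surj_on[OF w] by fastforce
        then have "x \<in> P (j + ?m)" "j + ?m < t" by (auto simp: P_def)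
        then show ?thesis by blast
      next
        case False
        then obtain C where C: "C \<in> \<C>" "x \<in> C" using x by (auto simp: W_def)
        then obtain j where j: "j < ?m" "C = c j" using bij_betw_imp_surj_on[OF c] by fastforce
        then have "x \<in> P j" "j < t" using C assms(3) by (auto simp: P_def)
        then show ?thesis by blast
      qed
    qed
  qed
  ultimately have "decomp t F P" unfolding decomp_def using assms(1,2) by blast
  then show ?thesis by blast
qed

end

section \<open>Matroids without large claws\<close>

locale claw_bounded = simple_matroid +
  fixes t :: nat
  assumes t_pos: "t \<ge> 1" and no_claw: "\<not> has_k_claw E I (t + 1)"
begin

subsection \<open>The lower bound\<close>

text \<open>Since \<open>t * (n div t) \<le> n < rk F\<close>, cocircuits all smaller than
  \<open>2 ^ (n div t)\<close> would yield a claw of size \<open>t + 1\<close> by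
  \<open>claw_if_small_cocircuits\<close>.\<close>

lemma large_cocircuit:
  assumes "fl F" "rk F = Suc n"
  shows "\<exists>H. hyp H F \<and> 2 ^ (n div t) \<le> card (F - H)"
proof (rule ccontr)
  assume "\<not> ?thesis"
  then have s: "card (F - H) < 2 ^ (n div t)" if "hyp H F" for H using that not_le by blast
  have "t * (n div t) < rk F" using assms by (simp add: le_imp_less_Suc)
  then obtain X where "claw E I X" "card X = Suc t"
    using claw_if_small_cocircuits[OF assms(1) s] by blast
  then show False using no_claw by (auto simp: has_k_claw_def)
qed

lemma card_hyp_split:
  assumes "hyp H F"
  shows "card F = card H + card (F - H)"
  using assms fl_finite card_mono[of F H] by (auto simp: hyp_def card_Diff_subset)

text \<open>The bound is proved for every flat: the induction passes to a hyperplane, and the size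
  of the removed cocircuit is at least the increment in \<open>f_Suc\<close>.\<close>

lemma card_ge_f:
  assumes "fl F"
  shows "f (rk F) t \<le> card F"
  using assms
proof (induction "rk F" arbitrary: F)
  case 0
  then show ?case using f_0[OF t_pos] by simp
next
  case (Suc n)
  obtain H where H: "hyp H F" "2 ^ (n div t) \<le> card (F - H)"
    using large_cocircuit[OF Suc(3)] Suc(2) by metis
  have "n = rk H" "fl H" using H Suc(2) by (auto simp: hyp_def)
  then have "f n t \<le> card H" using Suc(1)[of H] by simp
  then show ?case using card_hyp_split[OF H(1)] H(2) f_Suc[OF t_pos, of n] Suc(2) by simp
qed

text \<open>The hyperplane has at least \<open>f n t\<close> points itself, which leaves at most the
  increment of \<open>f\<close> for its complement.\<close>

lemma extremal_cocircuit_le: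
  assumes "rk F = Suc n" "card F = f (Suc n) t" "hyp H F"
  shows "card (F - H) \<le> 2 ^ (n div t)"
proof -
  have "rk H = n" "fl H" using assms by (auto simp: hyp_def)
  then have "f n t \<le> card H" using card_ge_f by blast
  then show ?thesis using card_hyp_split[OF assms(3)] assms(2) f_Suc[OF t_pos, of n] by simp
qed

subsection \<open>Extremal matroids\<close>

text \<open>In this range \<open>n div t\<close> is at most 1, so cocircuits have at most two
  elements and \<open>circuit_family\<close> applies; \<open>f_small\<close> gives the number of
  circuits.\<close>

lemma extremal_circuit_family:
  assumes "fl F" "rk F \<le> 2 * t" "card F = f (rk F) t"
  obtains \<C> where "\<C> \<subseteq> Pow F" "finite \<C>" "card \<C> = rk F - t"
    "\<And>C. C \<in> \<C> \<Longrightarrow> circuit E I C"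
    "\<And>C D. C \<in> \<C> \<Longrightarrow> D \<in> \<C> \<Longrightarrow> C \<noteq> D \<Longrightarrow> C \<inter> D = {}"
    "\<And>X. X \<subseteq> F \<Longrightarrow> I X \<longleftrightarrow> (\<forall>C\<in>\<C>. \<not> C \<subseteq> X)"
proof -
  have small: "card (F - H) \<le> 2" if h: "hyp H F" for H
  proof -
    obtain n where n: "rk F = Suc n" using h by (auto simp: hyp_def)
    have "n div t < 2" using n assms(2) t_pos by (simp add: div_less_iff_less_mult)
    then have "n div t \<le> 1" by simp
    then have "(2::nat) ^ (n div t) \<le> 2 ^ 1" by (intro power_increasing) auto
    then show ?thesis using extremal_cocircuit_le[OF n _ h] assms(3) n by simp
  qed
  obtain \<C> where \<C>: "\<C> \<subseteq> Pow F" "finite \<C>" "card F = rk F + card \<C>"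
    "\<And>C. C \<in> \<C> \<Longrightarrow> circuit E I C"
    "\<And>C D. C \<in> \<C> \<Longrightarrow> D \<in> \<C> \<Longrightarrow> C \<noteq> D \<Longrightarrow> C \<inter> D = {}"
    "\<And>X. X \<subseteq> F \<Longrightarrow> I X \<longleftrightarrow> (\<forall>C\<in>\<C>. \<not> C \<subseteq> X)"
    using circuit_family[OF assms(1) small] by metis
  have "card \<C> = rk F - t" using \<C>(3) f_small[OF t_pos assms(2)] assms(3) by simp
  then show ?thesis using that[OF \<C>(1,2) _ \<C>(4-6)] by blast
qed

text \<open>Here \<open>F\<close> has \<open>3 * t\<close> points and contains \<open>t\<close>
  disjoint circuits, each of size at least 3 by simplicity, so all of them are triangles.\<close>

lemma extremal_decomp_2t:
  assumes "fl F" "rk F = 2 * t" "card F = f (rk F) t"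
  shows "\<exists>P. decomp t F P"
proof -
  have r: "rk F \<le> 2 * t" using assms by simp
  have cF: "card F = rk F + (rk F - t)" using f_small[OF t_pos r] assms(3) by simp
  obtain \<C> where \<C>: "\<C> \<subseteq> Pow F" "finite \<C>" "card \<C> = rk F - t"
    "\<And>C. C \<in> \<C> \<Longrightarrow> circuit E I C"
    "\<And>C D. C \<in> \<C> \<Longrightarrow> D \<in> \<C> \<Longrightarrow> C \<noteq> D \<Longrightarrow> C \<inter> D = {}"
    "\<And>X. X \<subseteq> F \<Longrightarrow> I X \<longleftrightarrow> (\<forall>C\<in>\<C>. \<not> C \<subseteq> X)"
    using extremal_circuit_family[OF assms(1) r assms(3)] by metis
  have finF: "finite F" using assms fl_finite by blast
  have ge: "card C \<ge> 3" if "C \<in> \<C>" for C using \<C>(4)[OF that] simple by (simp add: simple_def)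
  have "card (\<Union>\<C>) = (\<Sum>C\<in>\<C>. card C)"
  proof (rule card_Union_disjoint)
    show "pairwise disjnt \<C>" using \<C>(5) by (auto simp: pairwise_def disjnt_def)
    show "finite C" if "C \<in> \<C>" for C using that \<C>(1) finite_subset[OF _ finF] by blast
  qed
  moreover have "card (\<Union>\<C>) \<le> card F" using \<C>(1) by (intro card_mono finF) auto
  moreover have "card F = (\<Sum>C\<in>\<C>. 3)" using \<C>(3) cF assms(2) by simp
  ultimately have le: "(\<Sum>C\<in>\<C>. card C) \<le> (\<Sum>C\<in>\<C>. 3)" by simp
  have tri: "card C = 3" if C: "C \<in> \<C>" for C
  proof (rule ccontr)
    assume "card C \<noteq> 3"
    then have "3 < card C" using ge[OF C] by simp
    then have "(\<Sum>C\<in>\<C>. 3) < (\<Sum>C\<in>\<C>. card C)"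
      using ge C by (intro sum_strict_mono_ex1[OF \<C>(2)]) auto
    then show False using le by simp
  qed
  show ?thesis by (rule triangles_decomp[OF t_pos assms(1) r cF \<C> tri])
qed

section \<open>Extremal flats of rank beyond \<open>2 * t\<close>\<close>

text \<open>Two points of a decomposed flat lie in the same part iff their line has a third point, so
  the parts of \<open>H\<close> and \<open>K\<close> agree on their common hyperplane \<open>H'\<close>. All parts of \<open>K\<close> have rank
  larger than \<open>P i \<inter> H'\<close>, hence \<open>K - H'\<close> extends precisely this part.\<close>

lemma hyp_complement_extends_part:
  assumes D: "decomp t H P" and D': "decomp t K P'"
    and rk: "rk H = n" "rk K = n" "2 * t \<le> n"
    and h: "hyp H' H" and h': "hyp H' K"
    and i: "i < t" "hyp (P i \<inter> H') (P i)" "rk (P i) = n div t"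
    and x: "x \<in> K - H'"
  shows "K - H' \<subseteq> cl (insert x (P i \<inter> H'))"
proof -
  let ?Q = "P i \<inter> H'"
  have d: "2 \<le> n div t" using rk(3) t_pos by (simp add: less_eq_div_iff_mult_less_eq)
  have rQ: "Suc (rk ?Q) = n div t" and flQ: "fl ?Q" using i by (auto simp: hyp_def)
  have H': "fl H'" "H' \<subseteq> H" "H' \<subseteq> K" using h h' by (auto simp: hyp_def)
  have KE: "K \<subseteq> E" using decompD(4)[OF D'] .
  have QE: "?Q \<subseteq> E" using flD(1)[OF flQ] .
  \<comment> \<open>The hypothesis \<open>2 * t \<le> n\<close> makes
    \<open>rk ?Q = n div t - 1\<close> positive; a point \<open>q\<close> of \<open>?Q\<close> then
    identifies the matching part of \<open>K\<close>.\<close>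
  have "?Q \<noteq> {}" using rQ d rk_empty by auto
  then obtain q where q: "q \<in> P i" "q \<in> H'" by blast
  then obtain m where m: "m < t" "q \<in> P' m" using decompD(3)[OF D'] H' by blast
  have AQ: "P' m \<inter> H' = ?Q"
  proof (rule set_eqI)
    fix a
    show "a \<in> P' m \<inter> H' \<longleftrightarrow> a \<in> ?Q"
    proof (cases "a \<in> H' \<and> a \<noteq> q")
      case True
      then have "a \<in> H" "a \<in> K" "q \<noteq> a" using H' by auto
      then show ?thesis
        using decomp_part_iff[OF D i(1) q(1)] decomp_part_iff[OF D' m] True by blast
    next
      case False
      then show ?thesis using q m by blast
    qed
  qed
  have "n div t \<le> rk (P' m)"
    using decompD(8)[OF D' m(1)] rk by (simp add: Mrt_comp_rank_def)
  then have "\<not> P' m \<subseteq> ?Q" using rk_mono[of "P' m" ?Q] rQ by auto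
  then obtain e where e: "e \<in> P' m" "e \<notin> H'" using AQ by blast
  have eK: "e \<in> K" "e \<in> E" using decompD(11)[OF D' m(1)] e KE by auto
  have sub: "K - H' \<subseteq> cl (insert e ?Q)"
  proof
    fix z assume z: "z \<in> K - H'"
    then obtain l where l: "l < t" "z \<in> P' l" using decompD(3)[OF D'] by blast
    \<comment> \<open>As \<open>e\<close> and \<open>H'\<close> span \<open>K\<close>, any part of
      \<open>K\<close> other than \<open>P' m\<close> is spanned inside \<open>H'\<close>; hence
      \<open>z\<close> lies in \<open>P' m\<close>, over \<open>?Q\<close> and
      \<open>e\<close>.\<close>
    have "z \<in> cl (insert e H' \<inter> P' l)"
    proof (rule cl_part[OF decompD(3-5)[OF D'] decompD(6)[OF D']])
      show "z \<in> cl (insert e H')" using hyp_cl_insert[OF h' eK(1) e(2)] z by blast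
    qed (use l eK H' in auto)
    moreover have "insert e H' \<inter> P' l \<subseteq> H'" if "l \<noteq> m"
      using decompD(6)[OF D' l(1) m(1) that] e by blast
    moreover have "insert e H' \<inter> P' l = insert e ?Q" if "l = m" using AQ e that by blast
    ultimately show "z \<in> cl (insert e ?Q)"
      using cl_subset_fl[OF H'(1), of "insert e H' \<inter> P' l"] z by (cases "l = m") auto
  qed
  have "x \<in> cl (insert e ?Q)" "x \<notin> cl ?Q" using sub x flD(2)[OF flQ] by auto
  then have "e \<in> cl (insert x ?Q)" using cl_exchange eK by blast
  moreover have xQ: "insert x ?Q \<subseteq> E" using x KE QE by blast
  ultimately have "cl (insert e ?Q) \<subseteq> cl (insert x ?Q)"
    using cl_increasing[OF xQ] by (intro cl_subset_cl[OF xQ]) auto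
  then show ?thesis using sub by blast
qed

text \<open>No hyperplane of \<open>F\<close> is smaller than \<open>H\<close>, so each member of
  the pencil through \<open>H'\<close> takes at least \<open>card (H - H')\<close> points of the
  cocircuit. This number is \<open>2 ^ rk (P i \<inter> H')\<close>, at least half of
  \<open>2 ^ (n div t)\<close>; so the two disjoint pieces of \<open>x\<close> and \<open>y\<close>
  are exact halves and span extremal hyperplanes, to which
  \<open>hyp_complement_extends_part\<close> applies.\<close>

lemma split_cocircuit:
  assumes F: "rk F = Suc n" "card F = f (Suc n) t" and n: "2 * t \<le> n"
    and H: "hyp H F" "card (F - H) = 2 ^ (n div t)" "decomp t H P"
    and IH: "\<forall>K. fl K \<and> rk K = n \<and> card K = f n t \<longrightarrow> (\<exists>P. decomp t K P)"
    and xy: "x \<in> F - H" "y \<in> F - H" "x \<noteq> y"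
  obtains H' i where "hyp H' H" "y \<notin> cl (insert x H')" "i < t"
    "\<And>j. j < t \<Longrightarrow> j \<noteq> i \<Longrightarrow> P j \<subseteq> H'" "rk (P i) = n div t"
    "2 \<le> card (cl (insert x H') - H)"
    "cl (insert x H') - H \<subseteq> cl (insert x (P i))"
    "F - H \<subseteq> cl (insert x (P i)) \<union> cl (insert y (P i))"
proof -
  let ?d = "n div t"
  have d: "2 \<le> ?d" using n t_pos by (simp add: less_eq_div_iff_mult_less_eq)
  obtain H' where H': "hyp H' H" "y \<notin> cl (insert x H')"
    using separating_hyp[OF H(1) xy] by metis
  obtain i where i: "i < t" "\<And>j. j < t \<Longrightarrow> j \<noteq> i \<Longrightarrow> P j \<subseteq> H'" "hyp (P i \<inter> H') (P i)"
    using decomp_hyp[OF H(3) H'(1)] by metis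
  let ?Q = "P i \<inter> H'"
  have rkH: "rk H = n" using H(1) F by (auto simp: hyp_def)
  have rP: "rk (P i) = Suc (rk ?Q)" using i(3) by (auto simp: hyp_def)
  have "?d \<le> rk (P i)" using decompD(8)[OF H(3) i(1)] rkH by (simp add: Mrt_comp_rank_def)
  then have dQ: "?d \<le> Suc (rk ?Q)" using rP by simp
  have finF: "finite (F - H)" using H(1) fl_finite by (auto simp: hyp_def)
  have H'H: "H' \<subseteq> H" using H'(1) by (simp add: hyp_def)
  have "H - H' = P i - ?Q"
    using decompD(3)[OF H(3)] i(1,2) by blast
  moreover have "card (P i) = card ?Q + card (P i - ?Q)" using card_hyp_split[OF i(3)] .
  ultimately have cH: "card (H - H') = 2 ^ rk ?Q"
    using pg_hyp_card(2,3)[OF decompD(7)[OF H(3) i(1)] i(3)] by simp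
  define K where "K z = cl (insert z H')" for z
  have K: "hyp (K z) F" "K z \<inter> H = H'" "hyp H' (K z)" "z \<in> K z" "K z - H = K z - H'"
    "2 ^ rk ?Q \<le> card (K z - H)" "K z - H \<subseteq> F - H"
    "card (K z) = card H' + card (K z - H)" if z: "z \<in> F - H" for z
  proof -
    show 1: "hyp (K z) F" and 2: "K z \<inter> H = H'" and 3: "hyp H' (K z)"
      unfolding K_def using hyp_pencil[OF H'(1) H(1) z] by auto
    have "insert z H' \<subseteq> E" using z H(1) H'H flD(1)[of F] by (auto simp: hyp_def)
    then show "z \<in> K z" unfolding K_def using cl_increasing by blast
    show 4: "K z - H = K z - H'" using 2 by blast
    show "K z - H \<subseteq> F - H" using 1 by (auto simp: hyp_def)
    show 5: "card (K z) = card H' + card (K z - H)" using card_hyp_split[OF 3] 4 by simp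
    \<comment> \<open>The cocircuit \<open>F - H\<close> has maximum size, so \<open>K z\<close> is
      at least as large as \<open>H\<close>.\<close>
    have "card (F - K z) \<le> 2 ^ ?d" using extremal_cocircuit_le[OF F 1] .
    then have "card H \<le> card (K z)"
      using card_hyp_split[OF 1] card_hyp_split[OF H(1)] H(2) by simp
    then show "2 ^ rk ?Q \<le> card (K z - H)" using 5 card_hyp_split[OF H'(1)] cH by simp
  qed
  have disj: "(K x - H) \<inter> (K y - H) = {}"
    unfolding K_def using hyp_pencil_disjoint[OF H'(1) H(1) xy(1,2) H'(2)] .
  have fins: "finite (K x - H)" "finite (K y - H)"
    using finite_subset[OF K(7)[OF xy(1)] finF] finite_subset[OF K(7)[OF xy(2)] finF] by auto
  have un: "card (K x - H) + card (K y - H) = card ((K x - H) \<union> (K y - H))"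
    using card_Un_disjoint[OF fins disj] by simp
  also have "\<dots> \<le> 2 ^ ?d"
    unfolding H(2)[symmetric] using K(7)[OF xy(1)] K(7)[OF xy(2)] finF by (intro card_mono) auto
  finally have le: "card (K x - H) + card (K y - H) \<le> 2 ^ ?d" .
  then have "2 ^ Suc (rk ?Q) \<le> (2::nat) ^ ?d" using K(6)[OF xy(1)] K(6)[OF xy(2)] by simp
  \<comment> \<open>Combined with the lower bound \<open>dQ\<close>, this shows that the part cut by
    \<open>H'\<close> is one of the smaller parts, of rank exactly \<open>?d\<close>.\<close>
  then have "Suc (rk ?Q) \<le> ?d" by (rule power_le_imp_le_exp[rotated]) simp
  then have dQ': "?d = Suc (rk ?Q)" using dQ by simp
  then have half: "card (K x - H) = 2 ^ rk ?Q" "card (K y - H) = 2 ^ rk ?Q"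
    using le K(6)[OF xy(1)] K(6)[OF xy(2)] by auto
  have cover: "F - H = (K x - H) \<union> (K y - H)"
  proof (rule sym, rule card_subset_eq[OF finF])
    show "K x - H \<union> (K y - H) \<subseteq> F - H" using K(7)[OF xy(1)] K(7)[OF xy(2)] by blast
    show "card (K x - H \<union> (K y - H)) = card (F - H)" using un half H(2) dQ' by simp
  qed
  have ext: "K z - H \<subseteq> cl (insert z (P i))" if z: "z \<in> F - H" and c: "card (K z - H) = 2 ^ rk ?Q" for z
  proof -
    have "rk (K z) = n" "fl (K z)" using K(1)[OF z] F by (auto simp: hyp_def)
    moreover have "card (K z) = card H" using K(8)[OF z] c cH card_hyp_split[OF H'(1)] by simp
    moreover have "card H = f n t"
      using card_hyp_split[OF H(1)] H(2) F(2) f_Suc[OF t_pos, of n] by simp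
    ultimately obtain P' where D': "decomp t (K z) P'" using IH by metis
    have zK: "z \<in> K z - H'" using K(4)[OF z] z H'H by blast
    have "rk (K z) = n" "rk (P i) = ?d" using \<open>rk (K z) = n\<close> rP dQ' by auto
    then have "K z - H' \<subseteq> cl (insert z ?Q)"
      using hyp_complement_extends_part[OF H(3) D' rkH _ n H'(1) K(3)[OF z] i(1,3) _ zK] by blast
    also have "\<dots> \<subseteq> cl (insert z (P i))" by (intro cl_mono) auto
    finally show ?thesis using K(5)[OF z] by simp
  qed
  have "(2::nat) ^ 1 \<le> 2 ^ rk ?Q" using dQ' d by (intro power_increasing) auto
  then have "2 \<le> card (K x - H)" using half by simp
  moreover have "rk (P i) = ?d" using rP dQ' by simp
  moreover have "F - H \<subseteq> cl (insert x (P i)) \<union> cl (insert y (P i))"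
    using cover ext[OF xy(1) half(1)] ext[OF xy(2) half(2)] by blast
  ultimately show ?thesis
    using that[OF H' i(1,2)] ext[OF xy(1) half(1)] unfolding K_def by blast
qed

text \<open>Two splittings of the cocircuit, the second one inside a half of the first, single out
  the same part \<open>P i\<close>, so the whole cocircuit extends \<open>P i\<close> to a flat
  \<open>N\<close>. The size of \<open>N\<close> is then that of a projective geometry, and
  thickness follows from the absence of a \<open>(t + 1)\<close>-claw.\<close>

lemma extremal_decomp_step:
  assumes F: "rk F = Suc n" "card F = f (Suc n) t" and n: "2 * t \<le> n" and flF: "fl F"
    and IH: "\<forall>K. fl K \<and> rk K = n \<and> card K = f n t \<longrightarrow> (\<exists>P. decomp t K P)"
  shows "\<exists>P. decomp t F P"
proof -
  let ?d = "n div t"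
  have d: "2 \<le> ?d" using n t_pos by (simp add: less_eq_div_iff_mult_less_eq)
  obtain H where hH: "hyp H F" "2 ^ ?d \<le> card (F - H)" using large_cocircuit[OF flF F(1)] by blast
  have cC: "card (F - H) = 2 ^ ?d" using extremal_cocircuit_le[OF F hH(1)] hH(2) by simp
  have "card H = f n t"
    using card_hyp_split[OF hH(1)] cC F(2) f_Suc[OF t_pos, of n] by simp
  moreover have rkH: "rk H = n" and flH: "fl H" and HF: "H \<subseteq> F" using hH(1) F by (auto simp: hyp_def)
  ultimately obtain P where D: "decomp t H P" using IH by blast
  have FE: "F \<subseteq> E" "finite F" using flD(1)[OF flF] fl_finite[OF flF] by auto
  note split = split_cocircuit[OF F n hH(1) cC D IH]
  have "(2::nat) ^ 1 < 2 ^ ?d" using d by (intro power_strict_increasing) auto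
  then have "2 \<le> card (F - H)" using cC by simp
  then obtain x y where xy: "x \<in> F - H" "y \<in> F - H" "x \<noteq> y"
    by (metis card_2_iff' obtain_subset_with_card_n subsetD)
  obtain H' i where i: "hyp H' H" "i < t" "rk (P i) = ?d" "2 \<le> card (cl (insert x H') - H)"
    "cl (insert x H') - H \<subseteq> cl (insert x (P i))"
    using split[OF xy] by metis
  obtain x' where x': "x' \<in> cl (insert x H') - H" "x' \<noteq> x"
    using i(4) by (metis card_2_iff' obtain_subset_with_card_n subsetD)
  have x'F: "x' \<in> F - H" "x' \<in> cl (insert x (P i))"
    using hyp_pencil(1)[OF i(1) hH(1) xy(1)] x' i(5) by (auto simp: hyp_def)
  obtain H'' i' where i': "hyp H'' H" "x' \<notin> cl (insert x H'')" "i' < t"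
    "\<And>j. j < t \<Longrightarrow> j \<noteq> i' \<Longrightarrow> P j \<subseteq> H''"
    "F - H \<subseteq> cl (insert x (P i')) \<union> cl (insert x' (P i'))"
    using split[OF xy(1) x'F(1) x'(2)[symmetric]] by metis
  \<comment> \<open>If the second splitting cut another part, \<open>H''\<close> would contain
    \<open>P i\<close>, and \<open>x'\<close> would be spanned by \<open>x\<close> and
    \<open>H''\<close>, against the choice of \<open>H''\<close>.\<close>
  have "i' = i"
  proof (rule ccontr)
    assume "i' \<noteq> i"
    then have "insert x (P i) \<subseteq> insert x H''" using i'(4)[OF i(2)] by auto
    then show False using cl_mono x'F(2) i'(2) by blast
  qed
  define N where "N = cl (insert x (P i))"
  have Pi: "fl (P i)" "P i \<subseteq> H" using decompD(9,11)[OF D i(2)] by auto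
  have xPE: "insert x (P i) \<subseteq> E" using Pi HF FE xy by blast
  have flN: "fl N" unfolding N_def by (rule fl_cl[OF xPE])
  have xN: "insert x (P i) \<subseteq> N" unfolding N_def by (rule cl_increasing[OF xPE])
  have hN: "hyp (P i) N" unfolding N_def using xy Pi FE by (intro cl_insert_hyp) auto
  have "cl (insert x' (P i)) \<subseteq> N" using x'F(2) xN by (intro cl_subset_fl[OF flN]) (auto simp: N_def)
  then have CN: "F - H \<subseteq> N" using i'(5) \<open>i' = i\<close> by (auto simp: N_def)
  have NF: "N \<subseteq> F" unfolding N_def using xy Pi HF by (intro cl_subset_fl[OF flF]) auto
  have "N \<inter> H = P i" using xN xy Pi by (intro hyp_maximal[OF hN] fl_Int flN flH) auto
  then have N: "N = P i \<union> (F - H)" using CN NF by blast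
  have rN: "rk N = Suc ?d" using hN i(3) by (simp add: hyp_def)
  have "card (P i) = 2 ^ ?d - 1" using decompD(7)[OF D i(2)] i(3) by (auto simp: pg_def)
  moreover have "card N = card (P i) + card (F - H)"
    unfolding N using Pi(2) FE(2) fl_finite[OF Pi(1)] by (intro card_Un_disjoint) auto
  ultimately have cN: "card N = 2 ^ Suc ?d - 1" using cC by simp
  have iF: "Mrt_comp_rank n t i = ?d" using decompD(8)[OF D i(2)] rkH i(3) by simp
  let ?a = "n mod t"
  have a: "?a < t" using t_pos by simp
  have ia: "?a \<le> i" using iF by (auto simp: Mrt_comp_rank_def split: if_splits)
  \<comment> \<open>The index whose rank grows from \<open>n\<close> to \<open>Suc n\<close> is
    \<open>?a\<close>. Both \<open>P i\<close> and \<open>P ?a\<close> have rank \<open>?d\<close>,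
    so they can trade places, which puts the enlarged part at the prescribed index.\<close>
  define P' where "P' j = (if j = ?a then N else if j = i then P ?a else P j)" for j
  define \<sigma> where "\<sigma> j = (if j = ?a then i else if j = i then ?a else j)" for j
  have \<sigma>t: "\<sigma> j < t" if "j < t" for j using that a i(2) by (auto simp: \<sigma>_def)
  have \<sigma>inj: "\<sigma> j \<noteq> \<sigma> k" if "j \<noteq> k" for j k using that by (auto simp: \<sigma>_def split: if_splits)
  have P'\<sigma>: "P' j = (if j = ?a then P (\<sigma> j) \<union> (F - H) else P (\<sigma> j))" for j
    using N by (auto simp: P'_def \<sigma>_def)
  have PH: "P (\<sigma> j) \<subseteq> H" if "j < t" for j using decompD(11)[OF D \<sigma>t[OF that]] .
  have union: "(\<Union>j<t. P' j) = F"
  proof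
    show "(\<Union>j<t. P' j) \<subseteq> F" using PH HF by (auto simp: P'\<sigma> split: if_splits)
    show "F \<subseteq> (\<Union>j<t. P' j)"
    proof
      fix e assume e: "e \<in> F"
      show "e \<in> (\<Union>j<t. P' j)"
      proof (cases "e \<in> H")
        case True
        then obtain j where j: "j < t" "e \<in> P j" using decompD(3)[OF D] by blast
        have "\<sigma> (\<sigma> j) = j" by (simp add: \<sigma>_def)
        then have "e \<in> P' (\<sigma> j)" using j by (auto simp: P'\<sigma>)
        then show ?thesis using \<sigma>t[OF j(1)] by blast
      next
        case False
        then have "e \<in> P' ?a" using e by (simp add: P'\<sigma>)
        then show ?thesis using a by blast
      qed
    qed
  qed
  have disj: "P' j \<inter> P' k = {}" if jk: "j < t" "k < t" "j \<noteq> k" for j k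
    using decompD(6)[OF D \<sigma>t[OF jk(1)] \<sigma>t[OF jk(2)] \<sigma>inj[OF jk(3)]] PH[OF jk(1)] PH[OF jk(2)] jk(3)
    by (auto simp: P'\<sigma>)
  have rank: "rk (P' j) = Mrt_comp_rank (Suc n) t j" if j: "j < t" for j
  proof (cases "j = ?a")
    case True
    then show ?thesis using rN Mrt_comp_rank_Suc[OF j, of n] by (simp add: P'_def)
  next
    case False
    then have "rk (P' j) = Mrt_comp_rank n t (\<sigma> j)"
      using decompD(8)[OF D \<sigma>t[OF j]] rkH by (simp add: P'\<sigma>)
    also have "\<dots> = Mrt_comp_rank (Suc n) t j"
      using False ia Mrt_comp_rank_Suc[OF j, of n] by (auto simp: Mrt_comp_rank_def \<sigma>_def)
    finally show ?thesis .
  qed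
  have "(\<Sum>j<t. rk (P' j)) = (\<Sum>j<t. Mrt_comp_rank (Suc n) t j)" using rank by (intro sum.cong) auto
  then have sum: "(\<Sum>j<t. rk (P' j)) \<le> rk F" using sum_Mrt_comp_rank[OF t_pos] F by simp
  have other: "pg (P' j) (Mrt_comp_rank (Suc n) t j)" if j: "j < t" "j \<noteq> ?a" for j
  proof -
    have "pg (P' j) (Mrt_comp_rank n t (\<sigma> j))"
      using decompD(7)[OF D \<sigma>t[OF j(1)]] rkH j(2) by (simp add: P'\<sigma>)
    then show ?thesis using rank[OF j(1)] by (auto simp: pg_def)
  qed
  have "thick N"
    unfolding thick_def
  proof (intro ballI impI, rule ccontr)
    fix u v assume uv: "u \<in> N" "v \<in> N" "u \<noteq> v" and no: "\<not> (\<exists>z\<in>cl {u, v}. z \<noteq> u \<and> z \<noteq> v)"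
    have uvE: "{u, v} \<subseteq> E" using uv flD(1)[OF flN] by blast
    have line: "cl {u, v} = {u, v}" using no cl_increasing[OF uvE] by blast
    have "\<exists>p. p \<in> P' j" if "j < t" for j
    proof -
      have "1 \<le> rk (P' j)" using rank[OF that] d Mrt_comp_rank_Suc[OF that, of n] by simp
      then have "P' j \<noteq> {}" using rk_empty by auto
      then show ?thesis by blast
    qed
    then obtain p where p: "\<And>j. j < t \<Longrightarrow> p j \<in> P' j" by metis
    \<comment> \<open>A two-point line in \<open>N\<close> and one point from each of the other
      \<open>t - 1\<close> parts would form a claw of size \<open>t + 1\<close>.\<close>
    define X where "X = {u, v} \<union> p ` ({..<t} - {?a})"
    have X1: "X \<inter> P' ?a = {u, v}"
    proof -
      have "p j \<notin> P' ?a" if "j < t" "j \<noteq> ?a" for j using disj[OF that(1) a that(2)] p[OF that(1)] by blast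
      moreover have "{u, v} \<subseteq> P' ?a" using uv by (simp add: P'_def)
      ultimately show ?thesis unfolding X_def by blast
    qed
    have X2: "X \<inter> P' j = {p j}" if j: "j < t" "j \<noteq> ?a" for j
    proof
      show "{p j} \<subseteq> X \<inter> P' j" using p j by (auto simp: X_def)
      show "X \<inter> P' j \<subseteq> {p j}"
      proof
        fix e assume e: "e \<in> X \<inter> P' j"
        then consider "e \<in> N" | k where "k < t" "e = p k" using uv by (auto simp: X_def)
        then show "e \<in> {p j}"
        proof cases
          case 1
          then show ?thesis using disj[OF j(1) a j(2)] e by (auto simp: P'_def[of ?a])
        next
          case 2
          then show ?thesis using disj[OF j(1) 2(1)] p[OF 2(1)] e by blast
        qed
      qed
    qed
    have PF: "P' j \<subseteq> F" if "j < t" for j using union that by blast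
    have XF: "X \<subseteq> F" using p PF uv NF by (auto simp: X_def)
    have pE: "p j \<in> E" if "j < t" for j using p[OF that] PF[OF that] FE by blast
    have XE: "X \<subseteq> E" using XF FE by blast
    have "I X"
    proof (rule indep_if_parts_indep[OF union FE(1) sum XF])
      fix j assume j: "j < t"
      show "I (X \<inter> P' j)"
        using X1 X2[OF j] indep_pair[of u v] indep_pair[of "p j" "p j"] uvE pE[OF j]
        by (cases "j = ?a") auto
    qed
    moreover have "cl X \<subseteq> X"
    proof
      fix z assume z: "z \<in> cl X"
      have "z \<in> F" using z cl_subset_fl[OF flF XF] by blast
      then obtain l where l: "l < t" "z \<in> P' l" using union by blast
      \<comment> \<open>The closure of \<open>X\<close> is computed part by part, and each trace is
        closed: the line \<open>{u, v}\<close> in \<open>N\<close>, a single point in every other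
        part.\<close>
      have "z \<in> cl (X \<inter> P' l)" using cl_part[OF union FE(1) sum disj XF l z] by blast
      moreover have "cl (X \<inter> P' l) = X \<inter> P' l"
        using X1 X2[OF l(1)] line cl_singleton[OF pE[OF l(1)]] by (cases "l = ?a") auto
      ultimately show "z \<in> X" by blast
    qed
    ultimately have "claw E I X" using cl_increasing[OF XE] XE by (auto simp: claw_def flat_def)
    moreover have "card X = t + 1"
    proof -
      have inj: "inj_on p ({..<t} - {?a})"
      proof (rule inj_onI, rule ccontr)
        fix j k assume jk: "j \<in> {..<t} - {?a}" "k \<in> {..<t} - {?a}" "p j = p k" "j \<noteq> k"
        then show False using disj[of j k] p[of j] p[of k] by auto
      qed
      have "{u, v} \<inter> p ` ({..<t} - {?a}) = {}"
      proof -
        have "p j \<notin> N" if "j < t" "j \<noteq> ?a" for j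
          using disj[OF that(1) a that(2)] p[OF that(1)] by (auto simp: P'_def[of ?a])
        then show ?thesis using uv by blast
      qed
      then have "card X = card {u, v} + card (p ` ({..<t} - {?a}))"
        unfolding X_def by (intro card_Un_disjoint) auto
      also have "\<dots> = 2 + (t - 1)" using card_image[OF inj] uv(3) a by simp
      finally show ?thesis using t_pos by simp
    qed
    ultimately show False using no_claw by (auto simp: has_k_claw_def)
  qed
  then have "pg N (Suc ?d)" using flN cN rN by (simp add: pg_def)
  moreover have "P' ?a = N" "Mrt_comp_rank (Suc n) t ?a = Suc ?d"
    using rank[OF a] rN by (simp_all add: P'_def)
  ultimately have pga: "pg (P' ?a) (Mrt_comp_rank (Suc n) t ?a)" by simp
  have "pg (P' j) (Mrt_comp_rank (rk F) t j)" if "j < t" for j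
    using other[OF that] pga F(1) by (cases "j = ?a") auto
  then have "decomp t F P'" unfolding decomp_def using t_pos flF union disj by blast
  then show ?thesis by blast
qed

lemma extremal_decomp:
  assumes "fl F" "2 * t \<le> rk F" "card F = f (rk F) t"
  shows "\<exists>P. decomp t F P"
  using assms
proof (induction "rk F" arbitrary: F)
  case 0
  then show ?case using t_pos by simp
next
  case (Suc n)
  show ?case
  proof (cases "rk F = 2 * t")
    case True
    then show ?thesis using extremal_decomp_2t Suc by blast
  next
    case False
    then have n: "2 * t \<le> n" using Suc by simp
    have "\<forall>K. fl K \<and> rk K = n \<and> card K = f n t \<longrightarrow> (\<exists>P. decomp t K P)"
      using Suc(1) n by simp
    then show ?thesis using extremal_decomp_step[OF _ _ n Suc(3)] Suc(2,5) by metis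
  qed
qed

end

text \<open>Alternative (ii) is encoded by a disjoint family \<C> of circuits such that a set is
  independent iff it contains none of them; points outside the union of \<C> are then
  coloops.\<close>

theorem theorem3p3:
  fixes E :: "'a set" and I :: "'a set \<Rightarrow> bool" and r t :: nat
  assumes "t \<ge> 1"
    and "matroid E I"
    and "simple E I"
    and "matroid_rank E I = r"
    and "\<not> has_k_claw E I (t + 1)"
  shows "card E \<ge> f r t \<and>
    (card E = f r t \<longrightarrow>
      (matroid_iso E I (Mrt_E r t) (Mrt_I r t) \<or>
       (t < r \<and> r < 2 * t \<and>
        (\<exists>\<C>. \<C> \<subseteq> Pow E \<and> finite \<C> \<and> card \<C> = r - t \<and>
              (\<forall>C \<in> \<C>. circuit E I C) \<and>
              (\<forall>C \<in> \<C>. \<forall>D \<in> \<C>. C \<noteq> D \<longrightarrow> C \<inter> D = {}) \<and>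
              (\<forall>X. X \<subseteq> E \<longrightarrow> (I X \<longleftrightarrow> (\<forall>C \<in> \<C>. \<not> C \<subseteq> X))) \<and>
              (\<exists>C \<in> \<C>. card C \<noteq> 3)))))"
proof -
  interpret claw_bounded E I t using assms by unfold_locales
  have r: "rk E = r" using assms(4) by (simp add: matroid_rank_def)
  show ?thesis
  proof (intro conjI impI)
    show "f r t \<le> card E" using card_ge_f[OF fl_ground] r by simp
    assume c: "card E = f r t"
    show "matroid_iso E I (Mrt_E r t) (Mrt_I r t) \<or>
       (t < r \<and> r < 2 * t \<and>
        (\<exists>\<C>. \<C> \<subseteq> Pow E \<and> finite \<C> \<and> card \<C> = r - t \<and>
              (\<forall>C \<in> \<C>. circuit E I C) \<and>
              (\<forall>C \<in> \<C>. \<forall>D \<in> \<C>. C \<noteq> D \<longrightarrow> C \<inter> D = {}) \<and>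
              (\<forall>X. X \<subseteq> E \<longrightarrow> (I X \<longleftrightarrow> (\<forall>C \<in> \<C>. \<not> C \<subseteq> X))) \<and>
              (\<exists>C \<in> \<C>. card C \<noteq> 3)))"
    proof (cases "r < 2 * t")
      case False
      then obtain P where "decomp t E P" using extremal_decomp[OF fl_ground] r c by auto
      from decomp_iso[OF this] show ?thesis unfolding r by (rule disjI1)
    next
      case True
      have rE: "rk E \<le> 2 * t" "card E = f (rk E) t" using True r c by auto
      obtain \<C> where \<C>: "\<C> \<subseteq> Pow E" "finite \<C>" "card \<C> = rk E - t"
        "\<And>C. C \<in> \<C> \<Longrightarrow> circuit E I C"
        "\<And>C D. C \<in> \<C> \<Longrightarrow> D \<in> \<C> \<Longrightarrow> C \<noteq> D \<Longrightarrow> C \<inter> D = {}"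
        "\<And>X. X \<subseteq> E \<Longrightarrow> I X \<longleftrightarrow> (\<forall>C\<in>\<C>. \<not> C \<subseteq> X)"
        using extremal_circuit_family[OF fl_ground rE] by metis
      show ?thesis
      \<comment> \<open>If all circuits are triangles, they and the coloops are the summands of
        \<open>M_{r,t}\<close>; this includes the free case, where \<C> is empty.\<close>
      proof (cases "\<forall>C\<in>\<C>. card C = 3")
        case tri: True
        have "card E = rk E + (rk E - t)" using f_small[OF t_pos rE(1)] rE(2) by simp
        then obtain P where "decomp t E P"
          using triangles_decomp[OF t_pos fl_ground rE(1) _ \<C>] tri by blast
        from decomp_iso[OF this] show ?thesis unfolding r by (rule disjI1)
      next
        case False
        \<comment> \<open>A circuit that is not a triangle makes \<open>card \<C> = r - t\<close>
          positive, which gives \<open>t < r\<close>.\<close>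
        then have "\<C> \<noteq> {}" by blast
        then have "card \<C> > 0" using \<C>(2) by (simp add: card_gt_0_iff)
        then have "t < r" using \<C>(3) r by simp
        moreover have "\<exists>C\<in>\<C>. card C \<noteq> 3" using False by blast
        ultimately show ?thesis
          using True \<C>(1,2,4-6) \<C>(3)[unfolded r] by (intro disjI2 conjI exI[of _ \<C>]) auto
      qed
    qed
  qed
qed

end
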